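(* Let $N$ be a positive integer, $0<\lambda<\Lambda$, and let $F:\mathcal S_N\to\mathbb R$ satisfy: (1) $F(0)=0$; (2) for all $M,M'\in\mathcal S_N$ with $M'\ge 0$, $\ \lambda\,\mathrm{tr}(M')\le F(M+M')-F(M)\le \Lambda\,\mathrm{tr}(M')$; (3) there exist positive constants $k^\pm,K^\pm$ with $\lambda\le k^\pm\le K^\pm\le\Lambda$ such that, for radial functions $u=u(r)$, $r=|x|$, $$F(D^2u)=\frac{N-1}{r}\big(k^+(u')^+-k^-(u')^-\big)+K^+(u'')^+-K^-(u'')^- .$$ Let $\alpha\in(-1,+\infty)$, $p>1+\alpha$, and let $0<a<b$. Then the problem $$-|\nabla u|^\alpha F(D^2u)=|u|^{p-1}u\ \text{ in }\mathcal A_{a,b},\qquad u=0\ \text{ on }\partial\mathcal A_{a,b},$$ has a radial solution that is positive in $\mathcal A_{a,b}$, and it also has a radial solution that is negative in $\mathcal A_{a,b}$.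
   Context: $\mathcal S_N$ is the space of real symmetric $N\times N$ matrices; $\mathcal A_{a,b}=\{x\in\mathbb R^N: a<|x|<b\}$; $y^+=\max(y,0)$ and $y^-=\max(-y,0)$. For a radial $\mathcal C^2$ function $u(r)$, $D^2u$ has eigenvalues $u''$ (simple, direction $x/|x|$) and $u'/r$ (multiplicity $N-1$); so condition (3) means $F(m\,e\otimes e+l(I-e\otimes e))=(N-1)(k^+l^+-k^-l^-)+K^+m^+-K^-m^-$ for all unit vectors $e$ and all $l,m\in\mathbb R$. Solutions are viscosity solutions in the sense of Birindelli and Demengel: $u$, continuous on $\overline\Omega$, is a subsolution (resp. supersolution) of $|\nabla u|^\alpha F(D^2u)+|u|^{p-1}u=0$ in an open set $\Omega$ if for every $x_0\in\Omega$, either $u$ is equal to a constant $c$ on some ball centred at $x_0$ and $|c|^{p-1}c\ge 0$ (resp. $\le 0$), or for every $\mathcal C^2$ function $\varphi$ such that $u-\varphi$ has a local maximum (resp. minimum) at $x_0$ and $\nabla\varphi(x_0)\ne0$, one has $|\nabla\varphi(x_0)|^\alpha F(D^2\varphi(x_0))+|u(x_0)|^{p-1}u(x_0)\ge 0$ (resp. $\le0$). A solution is a function that is both a subsolution and a supersolution. *)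

theory Defs
  imports "HOL-Analysis.Analysis"
begin

definition annulus :: "real \<Rightarrow> real \<Rightarrow> (real^'n) set" where
  "annulus a b = {x. a < norm x \<and> norm x < b}"

definition pos_part :: "real \<Rightarrow> real" where
  "pos_part y = max y 0"

definition neg_part :: "real \<Rightarrow> real" where
  "neg_part y = max (- y) 0"

definition symmetric_matrix :: "real^'n^'n \<Rightarrow> bool" where
  "symmetric_matrix M \<longleftrightarrow> transpose M = M"

definition nonneg_matrix :: "real^'n^'n \<Rightarrow> bool" where
  "nonneg_matrix M \<longleftrightarrow> symmetric_matrix M \<and> (\<forall>x. 0 \<le> x \<bullet> (M *v x))"

text \<open>A function of class \<open>C\<^sup>2\<close> on the open set \<open>S\<close>, presented together with its gradient \<open>g\<close> and
  its Hessian \<open>H\<close>, which are uniquely determined on \<open>S\<close>. The matrix \<open>H x\<close> is symmetric by Schwarz'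
  theorem.\<close>

definition C2_with :: "(real^'n) set \<Rightarrow> (real^'n \<Rightarrow> real) \<Rightarrow> (real^'n \<Rightarrow> real^'n) \<Rightarrow>
    (real^'n \<Rightarrow> real^'n^'n) \<Rightarrow> bool" where
  "C2_with S \<phi> g H \<longleftrightarrow>
     (\<forall>x\<in>S. GDERIV \<phi> x :> g x) \<and>
     (\<forall>x\<in>S. (g has_derivative (\<lambda>h. H x *v h)) (at x)) \<and>
     continuous_on S H"

text \<open>Operators are total functions on square matrices, but only their values on symmetric
  matrices are ever constrained or used.\<close>

definition uniformly_elliptic :: "real \<Rightarrow> real \<Rightarrow> (real^'n^'n \<Rightarrow> real) \<Rightarrow> bool" where
  "uniformly_elliptic lam Lam F \<longleftrightarrow>
     (\<forall>M M'. symmetric_matrix M \<longrightarrow> nonneg_matrix M' \<longrightarrow>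
        lam * trace M' \<le> F (M + M') - F M \<and> F (M + M') - F M \<le> Lam * trace M')"

definition radial_formula :: "(real^'n^'n \<Rightarrow> real) \<Rightarrow> real \<Rightarrow> real \<Rightarrow> real \<Rightarrow> real \<Rightarrow> bool" where
  "radial_formula F kp km Kp Km \<longleftrightarrow>
     (\<forall>w w1 w2 g H.
        (\<forall>r>0. (w has_real_derivative w1 r) (at r)) \<longrightarrow>
        (\<forall>r>0. (w1 has_real_derivative w2 r) (at r)) \<longrightarrow>
        continuous_on {0<..} w2 \<longrightarrow>
        C2_with (- {0}) (\<lambda>x. w (norm x)) g H \<longrightarrow>
        (\<forall>x. x \<noteq> 0 \<longrightarrow> (let r = norm x in
           F (H x) = (real CARD('n) - 1) / r * (kp * pos_part (w1 r) - km * neg_part (w1 r))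
                       + Kp * pos_part (w2 r) - Km * neg_part (w2 r))))"

text \<open>Viscosity solutions of \<open>|\<nabla>u|\<^sup>\<alpha> F(D\<^sup>2u) + |u|\<^bsup>p-1\<^esup>u = 0\<close> in the sense of Birindelli and
  Demengel. The alternative in that definition is a case distinction: the test-function condition
  is the criterion at points around which \<open>u\<close> is not constant. The cases have to be exclusive, since
  where \<open>u\<close> is locally constant no test function touching \<open>u\<close> has a nonzero gradient, so that the
  test-function condition holds vacuously there.\<close>

definition constant_near :: "(real^'n) set \<Rightarrow> (real^'n \<Rightarrow> real) \<Rightarrow> real \<Rightarrow> real^'n \<Rightarrow> bool" where
  "constant_near \<Omega> u c x0 \<longleftrightarrow> (\<exists>d>0. ball x0 d \<subseteq> \<Omega> \<and> (\<forall>x\<in>ball x0 d. u x = c))"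

definition viscosity_subsolution ::
    "real \<Rightarrow> real \<Rightarrow> (real^'n^'n \<Rightarrow> real) \<Rightarrow> (real^'n) set \<Rightarrow> (real^'n \<Rightarrow> real) \<Rightarrow> bool" where
  "viscosity_subsolution \<alpha> p F \<Omega> u \<longleftrightarrow>
     continuous_on (closure \<Omega>) u \<and>
     (\<forall>x0\<in>\<Omega>.
        (\<exists>c. constant_near \<Omega> u c x0 \<and> \<bar>c\<bar> powr (p - 1) * c \<ge> 0) \<or>
        ((\<nexists>c. constant_near \<Omega> u c x0) \<and>
         (\<forall>\<phi> g H. C2_with \<Omega> \<phi> g H \<longrightarrow>
            (\<forall>\<^sub>F x in at x0 within \<Omega>. u x - \<phi> x \<le> u x0 - \<phi> x0) \<longrightarrow> g x0 \<noteq> 0 \<longrightarrow>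
            norm (g x0) powr \<alpha> * F (H x0) + \<bar>u x0\<bar> powr (p - 1) * u x0 \<ge> 0)))"

definition viscosity_supersolution ::
    "real \<Rightarrow> real \<Rightarrow> (real^'n^'n \<Rightarrow> real) \<Rightarrow> (real^'n) set \<Rightarrow> (real^'n \<Rightarrow> real) \<Rightarrow> bool" where
  "viscosity_supersolution \<alpha> p F \<Omega> u \<longleftrightarrow>
     continuous_on (closure \<Omega>) u \<and>
     (\<forall>x0\<in>\<Omega>.
        (\<exists>c. constant_near \<Omega> u c x0 \<and> \<bar>c\<bar> powr (p - 1) * c \<le> 0) \<or>
        ((\<nexists>c. constant_near \<Omega> u c x0) \<and>
         (\<forall>\<phi> g H. C2_with \<Omega> \<phi> g H \<longrightarrow>
            (\<forall>\<^sub>F x in at x0 within \<Omega>. u x - \<phi> x \<ge> u x0 - \<phi> x0) \<longrightarrow> g x0 \<noteq> 0 \<longrightarrow>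
            norm (g x0) powr \<alpha> * F (H x0) + \<bar>u x0\<bar> powr (p - 1) * u x0 \<le> 0)))"

definition viscosity_solution ::
    "real \<Rightarrow> real \<Rightarrow> (real^'n^'n \<Rightarrow> real) \<Rightarrow> (real^'n) set \<Rightarrow> (real^'n \<Rightarrow> real) \<Rightarrow> bool" where
  "viscosity_solution \<alpha> p F \<Omega> u \<longleftrightarrow>
     viscosity_subsolution \<alpha> p F \<Omega> u \<and> viscosity_supersolution \<alpha> p F \<Omega> u"

definition dirichlet_solution ::
    "real \<Rightarrow> real \<Rightarrow> (real^'n^'n \<Rightarrow> real) \<Rightarrow> (real^'n) set \<Rightarrow> (real^'n \<Rightarrow> real) \<Rightarrow> bool" where
  "dirichlet_solution \<alpha> p F \<Omega> u \<longleftrightarrow>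
     viscosity_solution \<alpha> p F \<Omega> u \<and> (\<forall>x\<in>frontier \<Omega>. u x = 0)"

definition radial_on :: "(real^'n) set \<Rightarrow> (real^'n \<Rightarrow> real) \<Rightarrow> bool" where
  "radial_on S u \<longleftrightarrow> (\<exists>v. \<forall>x\<in>S. u x = v (norm x))"

end

theory Submission
  imports Defs "HOL-Complex_Analysis.Great_Picard"
begin

text \<open>For a radial function \<open>u\<close> with flux \<open>v = \<bar>u'\<bar>\<^bsup>\<alpha>\<^esup> u'\<close> the equation becomes the first order system
  \<open>u' = \<bar>v\<bar>\<^bsup>1/(1+\<alpha>)\<^esup> sgn v\<close>, \<open>v' = - G r v (\<mu> u\<^bsup>p\<^esup>)\<close> with \<open>\<mu> = 1\<close>; since \<open>p \<noteq> 1 + \<alpha>\<close>, any \<open>\<mu> > 0\<close> can be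
  reduced to \<open>\<mu> = 1\<close> by scaling \<open>u\<close>. We shoot in \<open>\<mu>\<close> from \<open>u a = 0\<close>, \<open>v a = 1\<close>. Without source
  (\<open>\<mu> = 0\<close>) the solution is positive at \<open>b\<close>, and for large \<open>\<mu>\<close> it is negative there, because a
  profile that stays nonnegative on the whole interval bounds \<open>\<mu>\<close>. As \<open>u\<close> is decreasing once it is
  negative, a solution with \<open>u b = 0\<close> is positive inside. The system is not Lipschitz, so shooting is
  done on retarded approximations, for which uniqueness is trivial. The profile is twice differentiable
  where \<open>u' \<noteq> 0\<close>, which are the only points where the viscosity condition says anything. Negative
  solutions come from positive ones for the operator \<open>- F (- M)\<close>.\<close>

section \<open>Shooting without uniqueness\<close>

text \<open>The radial equation is singular or degenerate where u' = 0, but |u'|^\<alpha> u'' = v' /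
  (1 + \<alpha>), and the tangential term is positively homogeneous in u', so multiplying by
  |u'|^\<alpha> leaves an equation in v. The map m -> K^+ m^+ - K^- m^- is increasing and piecewise
  linear; inverting it gives G, with G r v y = c y + O(|v|) and c = (1 + \<alpha>) / K^-. The error
  O(|v|) costs only exponential factors, by Gronwall. Up to these, v' = - \<beta> u^p with \<beta> =
  c \<mu>, so a flux that has turned negative stays negative and u behaves like a concave function.
  The bound on \<mu> combines two facts about the maximum M of a nonnegative profile. Balancing flux
  against source beside the maximum gives \<beta> M^p \<le> C M^(1 + \<alpha>). Moreover M is
  bounded below: either the source is too weak to consume the initial flux 1, and u climbs a
  definite height, or the source is strong and the first inequality bounds M from below. Since p > 1
  + \<alpha>, together they bound \<beta>.\<close>

text \<open>No order between \<open>a\<close>, \<open>s\<close> and \<open>t\<close> is assumed: the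
  integral over \<open>{a..t}\<close> is 0 for \<open>t < a\<close>, so approximations built from it
  are constant to the left of \<open>a\<close>, where retarded arguments may fall.\<close>

lemma integral_lipschitz:
  fixes g :: "real \<Rightarrow> 'a::euclidean_space"
  assumes g: "continuous_on UNIV g" and bd: "\<And>t. norm (g t) \<le> C"
  shows "norm (integral {a..t} g - integral {a..s} g) \<le> C * \<bar>t - s\<bar>"
proof -
  have C: "0 \<le> C" using bd[of 0] norm_ge_zero order_trans by blast
  have bnd: "norm (integral {x..y} g) \<le> C * (y - x)" if "x \<le> y" for x y
    using that integral_bound[of x y g C] g bd continuous_on_subset by blast
  have *: "norm (integral {a..t} g - integral {a..s} g) \<le> C * (t - s)" if "s \<le> t" for s t
  proof (cases "a \<le> s")
    case True
    have "integral {a..s} g + integral {s..t} g = integral {a..t} g"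
      using True that g
      by (intro Henstock_Kurzweil_Integration.integral_combine integrable_continuous_real)
        (auto intro: continuous_on_subset)
    then have "integral {a..t} g - integral {a..s} g = integral {s..t} g"
      by (simp add: algebra_simps)
    then show ?thesis using bnd[OF that] by simp
  next
    case False
    then have 0: "integral {a..s} g = 0" by simp
    show ?thesis
    proof (cases "a \<le> t")
      case True
      have "C * (t - a) \<le> C * (t - s)" using False C by (intro mult_left_mono) auto
      then show ?thesis using bnd[OF True] 0 by simp
    next
      case False
      then show ?thesis using 0 that C by simp
    qed
  qed
  show ?thesis
    using *[of s t] *[of t s] by (cases "s \<le> t") (auto simp: norm_minus_commute)
qed

text \<open>Tonelli's retarded iteration. On the time interval up to \<open>a + m * \<delta>\<close>, step \<open>m\<close> solves
  \<open>y' t = f t (y (t - \<delta>))\<close>, since the retarded right-hand side only involves earlier values.\<close>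

primrec tonelli :: "(real \<Rightarrow> 'a \<Rightarrow> 'a) \<Rightarrow> real \<Rightarrow> 'a \<Rightarrow> real \<Rightarrow> nat \<Rightarrow> real \<Rightarrow> 'a::euclidean_space" where
  "tonelli f a y0 \<delta> 0 = (\<lambda>t. y0)"
| "tonelli f a y0 \<delta> (Suc m) = (\<lambda>t. y0 + integral {a..t} (\<lambda>s. f s (tonelli f a y0 \<delta> m (s - \<delta>))))"

text \<open>The Lipschitz constant is the bound on \<open>f\<close>, independent of \<open>m\<close>
  and \<open>\<delta>\<close>; this is the equicontinuity needed for compactness. Continuity of each
  iterate, needed to integrate the next one, follows from it.\<close>

lemma tonelli_continuous_lipschitz:
  fixes f :: "real \<Rightarrow> 'a::euclidean_space \<Rightarrow> 'a"
  assumes f: "continuous_on UNIV (\<lambda>(t, x). f t x)" and bd: "\<And>t x. norm (f t x) \<le> C"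
  shows "continuous_on UNIV (tonelli f a y0 \<delta> m)"
    and "norm (tonelli f a y0 \<delta> m t - tonelli f a y0 \<delta> m s) \<le> C * \<bar>t - s\<bar>"
proof -
  have C: "0 \<le> C" using bd[of 0 0] norm_ge_zero order_trans by blast
  have cont: "continuous_on UNIV y" if "\<And>t s. norm (y t - y s) \<le> C * \<bar>t - s\<bar>"
    for y :: "real \<Rightarrow> 'a"
    using that C by (intro lipschitz_on_continuous_on[of C] lipschitz_onI) (auto simp: dist_norm)
  have *: "\<forall>t s. norm (tonelli f a y0 \<delta> m t - tonelli f a y0 \<delta> m s) \<le> C * \<bar>t - s\<bar>" for m
  proof (induction m)
    case 0
    then show ?case using C by simp
  next
    case (Suc m)
    have "continuous_on UNIV (\<lambda>s. (s, tonelli f a y0 \<delta> m (s - \<delta>)))"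
      by (intro continuous_on_Pair continuous_on_compose2[OF cont[OF Suc[rule_format]]] continuous_intros) auto
    from continuous_on_compose2[OF f this]
    have "continuous_on UNIV (\<lambda>s. f s (tonelli f a y0 \<delta> m (s - \<delta>)))" by simp
    from integral_lipschitz[OF this bd] show ?case by simp
  qed
  show "continuous_on UNIV (tonelli f a y0 \<delta> m)" using cont * by blast
  show "norm (tonelli f a y0 \<delta> m t - tonelli f a y0 \<delta> m s) \<le> C * \<bar>t - s\<bar>" using * by blast
qed

lemma continuous_on_tonelli_integrand:
  fixes f :: "real \<Rightarrow> 'a::euclidean_space \<Rightarrow> 'a"
  assumes f: "continuous_on UNIV (\<lambda>(t, x). f t x)" and bd: "\<And>t x. norm (f t x) \<le> C"
  shows "continuous_on UNIV (\<lambda>s. f s (tonelli f a y0 \<delta> m (s - \<delta>)))"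
proof -
  have "continuous_on UNIV (\<lambda>s. (s, tonelli f a y0 \<delta> m (s - \<delta>)))"
    by (intro continuous_on_Pair continuous_intros
        continuous_on_compose2[OF tonelli_continuous_lipschitz(1)[OF f bd]]) auto
  from continuous_on_compose2[OF f this] show ?thesis by simp
qed

text \<open>Retardation moves the argument back by one window of length \<open>\<delta>\<close>, so
  the window of agreement grows by one with each step. For \<open>m = 0\<close> the interval of
  integration is empty or a single point.\<close>

lemma tonelli_stable:
  assumes "0 \<le> \<delta>" "t \<le> a + real m * \<delta>"
  shows "tonelli f a y0 \<delta> (Suc m) t = tonelli f a y0 \<delta> m t"
  using assms(2)
proof (induction m arbitrary: t)
  case 0
  then show ?case by (cases "t = a") auto
next
  case (Suc m)
  have "integral {a..t} (\<lambda>s. f s (tonelli f a y0 \<delta> (Suc m) (s - \<delta>)))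
      = integral {a..t} (\<lambda>s. f s (tonelli f a y0 \<delta> m (s - \<delta>)))"
  proof (rule integral_cong)
    fix s assume "s \<in> {a..t}"
    then have "s - \<delta> \<le> a + real m * \<delta>" using Suc.prems by (simp add: algebra_simps)
    then show "f s (tonelli f a y0 \<delta> (Suc m) (s - \<delta>)) = f s (tonelli f a y0 \<delta> m (s - \<delta>))"
      using Suc.IH by simp
  qed
  then show ?case by simp
qed

text \<open>Each iterate is obtained by finitely many integrations, so dominated convergence,
  applied once per step, replaces any uniqueness argument.\<close>

lemma tonelli_tendsto_parameter:
  fixes f :: "real \<Rightarrow> real \<Rightarrow> 'a::euclidean_space \<Rightarrow> 'a"
  assumes f: "continuous_on UNIV (\<lambda>(\<mu>, t, x). f \<mu> t x)" and bd: "\<And>\<mu> t x. norm (f \<mu> t x) \<le> C"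
    and \<mu>: "\<mu> \<longlonglongrightarrow> \<nu>"
  shows "(\<lambda>k. tonelli (f (\<mu> k)) a y0 \<delta> m t) \<longlonglongrightarrow> tonelli (f \<nu>) a y0 \<delta> m t"
proof (induction m arbitrary: t)
  case 0
  then show ?case by simp
next
  case (Suc m)
  have f': "continuous_on UNIV (\<lambda>(t, x). f \<mu> t x)" for \<mu>
    using continuous_on_compose2[OF f continuous_on_Pair[OF continuous_on_const[of UNIV \<mu>] continuous_on_id]]
    by (simp add: case_prod_beta')
  have "(\<lambda>k. integral {a..t} (\<lambda>s. f (\<mu> k) s (tonelli (f (\<mu> k)) a y0 \<delta> m (s - \<delta>))))
      \<longlonglongrightarrow> integral {a..t} (\<lambda>s. f \<nu> s (tonelli (f \<nu>) a y0 \<delta> m (s - \<delta>)))"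
  proof (rule dominated_convergence(2))
    show "(\<lambda>s. f (\<mu> k) s (tonelli (f (\<mu> k)) a y0 \<delta> m (s - \<delta>))) integrable_on {a..t}" for k
      by (rule integrable_continuous_real[OF continuous_on_subset[OF
            continuous_on_tonelli_integrand[OF f' bd] subset_UNIV]])
    show "(\<lambda>s. C) integrable_on {a..t}" by (rule integrable_const_ivl)
    show "(\<lambda>k. f (\<mu> k) s (tonelli (f (\<mu> k)) a y0 \<delta> m (s - \<delta>)))
        \<longlonglongrightarrow> f \<nu> s (tonelli (f \<nu>) a y0 \<delta> m (s - \<delta>))" for s
    proof -
      have "(\<lambda>k. (\<mu> k, s, tonelli (f (\<mu> k)) a y0 \<delta> m (s - \<delta>)))
          \<longlonglongrightarrow> (\<nu>, s, tonelli (f \<nu>) a y0 \<delta> m (s - \<delta>))"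
        by (intro tendsto_Pair \<mu> Suc tendsto_const)
      from continuous_on_tendsto_compose[OF f this] show ?thesis by simp
    qed
  qed (use bd in auto)
  then show ?case by (auto intro: tendsto_intros)
qed

text \<open>The bound \<open>C\<close> makes the approximations equi-Lipschitz, so Arzela-Ascoli
  applies, and it also makes the effect of the retardation vanish in the limit. The sequence
  \<open>r\<close> allows the step numbers to be thinned out beforehand, which arguments about
  infinitely many bad step numbers require.\<close>

lemma tonelli_subseq_limit:
  fixes f :: "real \<Rightarrow> real \<Rightarrow> 'a::euclidean_space \<Rightarrow> 'a"
  assumes f: "continuous_on UNIV (\<lambda>(\<mu>, t, x). f \<mu> t x)" and bd: "\<And>\<mu> t x. norm (f \<mu> t x) \<le> C"
    and \<mu>: "\<And>n. \<mu> n \<in> {m0..m1}" and ab: "a \<le> b" and r: "strict_mono r"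
  obtains k \<nu> y where "strict_mono (k :: nat \<Rightarrow> nat)" "\<nu> \<in> {m0..m1}"
    "(\<lambda>n. \<mu> (k n)) \<longlonglongrightarrow> \<nu>"
    "(\<lambda>n. tonelli (f (\<mu> (k n))) a y0 ((b - a) / real (Suc (r (k n)))) (Suc (r (k n))) b) \<longlonglongrightarrow> y b"
    "y a = y0" "continuous_on {a..b} y"
    "\<And>t. t \<in> {a..b} \<Longrightarrow> (y has_vector_derivative f \<nu> t (y t)) (at t within {a..b})"
proof -
  define d where "d n = (b - a) / real (Suc (r n))" for n
  define X where "X n = tonelli (f (\<mu> n)) a y0 (d n) (Suc (r n))" for n
  have f': "continuous_on UNIV (\<lambda>(t, x). f \<mu> t x)" for \<mu>
    using continuous_on_compose2[OF f continuous_on_Pair[OF continuous_on_const[of UNIV \<mu>] continuous_on_id]]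
    by (simp add: case_prod_beta')
  have C: "0 \<le> C" using bd[of 0 0 0] norm_ge_zero order_trans by blast
  have Xlip: "norm (X n t - X n s) \<le> C * \<bar>t - s\<bar>" for n t s
    unfolding X_def by (rule tonelli_continuous_lipschitz(2)[OF f' bd])
  have Xcont: "continuous_on UNIV (X n)" for n
    unfolding X_def by (rule tonelli_continuous_lipschitz(1)[OF f' bd])
  have Xa: "X n a = y0" for n by (simp add: X_def)
  have d0: "0 \<le> d n" for n using ab by (simp add: d_def)
  \<comment> \<open>\<open>Suc (r n)\<close> steps of length \<open>d n\<close> reach
    \<open>b\<close> exactly. For times up to \<open>b\<close> the retarded argument therefore lies
    where the last two iterates agree, so \<open>X n\<close> solves the retarded equation
    itself.\<close>
  have Xeq: "X n t = y0 + integral {a..t} (\<lambda>s. f (\<mu> n) s (X n (s - d n)))" if "t \<le> b" for n t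
  proof -
    have e: "a + real (Suc (r n)) * d n = b" by (simp add: d_def)
    have "integral {a..t} (\<lambda>s. f (\<mu> n) s (tonelli (f (\<mu> n)) a y0 (d n) (r n) (s - d n)))
      = integral {a..t} (\<lambda>s. f (\<mu> n) s (X n (s - d n)))"
    proof (rule integral_cong)
      fix s assume "s \<in> {a..t}"
      then have "s - d n \<le> a + real (r n) * d n" using e that by (simp add: algebra_simps)
      from tonelli_stable[OF d0 this, where f = "f (\<mu> n)" and ?y0.0 = y0]
      show "f (\<mu> n) s (tonelli (f (\<mu> n)) a y0 (d n) (r n) (s - d n)) = f (\<mu> n) s (X n (s - d n))"
        unfolding X_def by (simp only:)
    qed
    then show ?thesis unfolding X_def by simp
  qed
  obtain \<nu> k1 where k1: "\<nu> \<in> {m0..m1}" "strict_mono (k1 :: nat \<Rightarrow> nat)" "(\<mu> \<circ> k1) \<longlonglongrightarrow> \<nu>"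
    using \<mu> compact_Icc[of m0 m1] unfolding compact_def by blast
  obtain y k2 where y: "continuous_on {a..b} y" and k2: "strict_mono (k2 :: nat \<Rightarrow> nat)"
    and unif: "\<And>e. 0 < e \<Longrightarrow> \<exists>N. \<forall>n x. n \<ge> N \<and> x \<in> {a..b} \<longrightarrow> norm (X (k1 (k2 n)) x - y x) < e"
  proof (rule Arzela_Ascoli[of "{a..b}" "\<lambda>n. X (k1 n)" "norm y0 + C * (b - a)"])
    show "norm (X (k1 n) x) \<le> norm y0 + C * (b - a)" if "x \<in> {a..b}" for n x
    proof -
      have "norm (X (k1 n) x) \<le> norm (X (k1 n) a) + norm (X (k1 n) x - X (k1 n) a)"
        by (simp add: norm_triangle_sub)
      also have "\<dots> \<le> norm y0 + C * \<bar>x - a\<bar>" using Xlip[of "k1 n" x a] Xa by simp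
      also have "\<dots> \<le> norm y0 + C * (b - a)" using that C by (intro add_mono mult_left_mono) auto
      finally show ?thesis .
    qed
    show "\<exists>d>0. \<forall>n y. y \<in> {a..b} \<and> norm (x - y) < d \<longrightarrow> norm (X (k1 n) x - X (k1 n) y) < e"
      if "x \<in> {a..b}" "0 < e" for x e
    proof (intro exI conjI allI impI)
      show "0 < e / (C + 1)" using that C by simp
      fix n y assume "y \<in> {a..b} \<and> norm (x - y) < e / (C + 1)"
      then have h: "\<bar>x - y\<bar> * (C + 1) < e" using C by (simp add: pos_less_divide_eq)
      have "norm (X (k1 n) x - X (k1 n) y) \<le> C * \<bar>x - y\<bar>" by (rule Xlip)
      also have "\<dots> \<le> \<bar>x - y\<bar> * (C + 1)" by (simp add: algebra_simps)
      finally show "norm (X (k1 n) x - X (k1 n) y) < e" using h by simp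
    qed
  qed auto
  define k where "k = k1 \<circ> k2"
  have k: "strict_mono k" unfolding k_def using k1(2) k2 by (rule strict_mono_o)
  have \<mu>k: "(\<lambda>n. \<mu> (k n)) \<longlonglongrightarrow> \<nu>"
    using LIMSEQ_subseq_LIMSEQ[OF k1(3) k2] by (simp add: k_def o_def)
  have Xk: "(\<lambda>n. X (k n) t) \<longlonglongrightarrow> y t" if "t \<in> {a..b}" for t
    using unif that unfolding LIMSEQ_iff k_def by simp blast
  have dk: "(\<lambda>n. d (k n)) \<longlonglongrightarrow> 0"
  proof -
    have "strict_mono (\<lambda>n. r (k n))" using strict_mono_o[OF r k] by (simp add: o_def)
    then have "filterlim (\<lambda>n. r (k n)) sequentially sequentially" by (rule filterlim_subseq)
    then have "filterlim (\<lambda>n. Suc (r (k n))) sequentially sequentially"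
      using filterlim_compose[OF filterlim_Suc] by blast
    then have "filterlim (\<lambda>n. real (Suc (r (k n)))) at_top sequentially"
      by (rule filterlim_compose[OF filterlim_real_sequentially])
    then show ?thesis unfolding d_def
      by (intro real_tendsto_divide_at_top) auto
  qed
  have Xkd: "(\<lambda>n. X (k n) (t - d (k n))) \<longlonglongrightarrow> y t" if "t \<in> {a..b}" for t
  proof (rule Lim_transform[OF Xk[OF that]])
    have "(\<lambda>n. C * d (k n)) \<longlonglongrightarrow> 0" using tendsto_mult_left[OF dk, of C] by simp
    moreover have "\<forall>n. norm (X (k n) (t - d (k n)) - X (k n) t) \<le> C * d (k n)"
      using Xlip[of "k _" "t - d (k _)" t] d0 by simp
    ultimately show "(\<lambda>n. X (k n) (t - d (k n)) - X (k n) t) \<longlonglongrightarrow> 0"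
      by (rule Lim_null_comparison[OF always_eventually, rotated])
  qed
  have yeq: "y t = y0 + integral {a..t} (\<lambda>s. f \<nu> s (y s))" if t: "t \<in> {a..b}" for t
  proof -
    have "(\<lambda>n. integral {a..t} (\<lambda>s. f (\<mu> (k n)) s (X (k n) (s - d (k n)))))
      \<longlonglongrightarrow> integral {a..t} (\<lambda>s. f \<nu> s (y s))"
    proof (rule dominated_convergence(2))
      show "(\<lambda>s. f (\<mu> (k n)) s (X (k n) (s - d (k n)))) integrable_on {a..t}" for n
        unfolding X_def
        by (rule integrable_continuous_real[OF continuous_on_subset[OF
              continuous_on_tonelli_integrand[OF f' bd] subset_UNIV]])
      show "(\<lambda>s. C) integrable_on {a..t}" by (rule integrable_const_ivl)
      show "(\<lambda>n. f (\<mu> (k n)) s (X (k n) (s - d (k n)))) \<longlonglongrightarrow> f \<nu> s (y s)" if "s \<in> {a..t}" for s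
      proof -
        have "(\<lambda>n. (\<mu> (k n), s, X (k n) (s - d (k n)))) \<longlonglongrightarrow> (\<nu>, s, y s)"
          using that t by (intro tendsto_Pair \<mu>k Xkd tendsto_const) auto
        from continuous_on_tendsto_compose[OF f this] show ?thesis by simp
      qed
    qed (use bd in auto)
    then have "(\<lambda>n. X (k n) t) \<longlonglongrightarrow> y0 + integral {a..t} (\<lambda>s. f \<nu> s (y s))"
      using t by (simp add: Xeq tendsto_add)
    then show ?thesis using Xk[OF t] LIMSEQ_unique by blast
  qed
  have fy: "continuous_on {a..b} (\<lambda>s. f \<nu> s (y s))"
    using continuous_on_compose2[OF f' continuous_on_Pair[OF continuous_on_id y] subset_UNIV] by simp
  have der: "(y has_vector_derivative f \<nu> t (y t)) (at t within {a..b})" if t: "t \<in> {a..b}" for t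
  proof -
    have "((\<lambda>t. y0 + integral {a..t} (\<lambda>s. f \<nu> s (y s))) has_vector_derivative f \<nu> t (y t))
        (at t within {a..b})"
      using integral_has_vector_derivative[OF fy t] by (auto intro: derivative_eq_intros)
    then show ?thesis
      by (rule has_vector_derivative_transform[OF t, rotated]) (rule yeq)
  qed
  show ?thesis
    using that[OF k k1(1) \<mu>k _ _ y der] Xk[of b] yeq[of a] ab
    unfolding X_def d_def by simp
qed

definition ode_solution :: "(real \<Rightarrow> 'a \<Rightarrow> 'a) \<Rightarrow> real \<Rightarrow> real \<Rightarrow> 'a \<Rightarrow> (real \<Rightarrow> 'a::euclidean_space) \<Rightarrow> bool"
  where "ode_solution f a b y0 y \<longleftrightarrow> y a = y0 \<and> continuous_on {a..b} y \<and>
    (\<forall>t\<in>{a..b}. (y has_vector_derivative f t (y t)) (at t within {a..b}))"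

text \<open>A shooting lemma that needs no uniqueness for the initial value problem: the intermediate value
  theorem is applied to the approximations, which do depend continuously on the parameter, and the
  solution is obtained as a limit.\<close>

lemma peano_shooting:
  fixes f :: "real \<Rightarrow> real \<Rightarrow> 'a::euclidean_space \<Rightarrow> 'a" and \<phi> :: "'a \<Rightarrow> real"
  assumes f: "continuous_on UNIV (\<lambda>(\<mu>, t, x). f \<mu> t x)" and bd: "\<And>\<mu> t x. norm (f \<mu> t x) \<le> C"
    and m: "m0 \<le> m1" and ab: "a \<le> b" and \<phi>: "continuous_on UNIV \<phi>"
    and lo: "\<And>y. ode_solution (f m0) a b y0 y \<Longrightarrow> 0 < \<phi> (y b)" and hi: "\<And>y. ode_solution (f m1) a b y0 y \<Longrightarrow> \<phi> (y b) < 0"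
  shows "\<exists>\<mu>\<in>{m0..m1}. \<exists>y. ode_solution (f \<mu>) a b y0 y \<and> \<phi> (y b) = 0"
proof -
  define Y where "Y n \<mu> = tonelli (f \<mu>) a y0 ((b - a) / real (Suc n)) (Suc n) b" for n \<mu>
  have lim: "\<exists>k \<nu> y. strict_mono (k :: nat \<Rightarrow> nat) \<and> \<nu> \<in> {c0..c1} \<and> (\<lambda>n. \<mu> (k n)) \<longlonglongrightarrow> \<nu> \<and>
      (\<lambda>n. \<phi> (Y (r (k n)) (\<mu> (k n)))) \<longlonglongrightarrow> \<phi> (y b) \<and> ode_solution (f \<nu>) a b y0 y"
    if mem: "\<And>n. \<mu> n \<in> {c0..c1}" and mono: "strict_mono r" for \<mu> c0 c1 and r :: "nat \<Rightarrow> nat"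
  proof -
    obtain k \<nu> y where k: "strict_mono (k :: nat \<Rightarrow> nat)" "\<nu> \<in> {c0..c1}" "(\<lambda>n. \<mu> (k n)) \<longlonglongrightarrow> \<nu>"
      and l: "(\<lambda>n. Y (r (k n)) (\<mu> (k n))) \<longlonglongrightarrow> y b" and y: "y a = y0" "continuous_on {a..b} y"
        "\<And>t. t \<in> {a..b} \<Longrightarrow> (y has_vector_derivative f \<nu> t (y t)) (at t within {a..b})"
      by (rule tonelli_subseq_limit[OF f bd mem ab mono, where ?y0.0 = y0])
        (rule that; simp only: Y_def)
    have "(\<lambda>n. \<phi> (Y (r (k n)) (\<mu> (k n)))) \<longlonglongrightarrow> \<phi> (y b)"
      using continuous_on_tendsto_compose[OF \<phi> l] by simp
    then show ?thesis using k y unfolding ode_solution_def by blast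
  qed
  have sub: "\<exists>r :: nat \<Rightarrow> nat. strict_mono r \<and> (\<forall>n. P (r n))" if "\<not> eventually (\<lambda>n. \<not> P n) sequentially"
    for P :: "nat \<Rightarrow> bool"
  proof -
    have "infinite {n. P n}"
      using that by (metis cofinite_eq_sequentially eventually_cofinite mem_Collect_eq not_not
          Collect_cong)
    then show ?thesis using infinite_enumerate[of "{n. P n}"] by auto
  qed
  \<comment> \<open>The sign at the endpoint is known for solutions, not for approximations. If
    infinitely many approximations had the wrong sign, a subsequence would converge to a solution
    with the wrong sign.\<close>
  have ev0: "eventually (\<lambda>n. \<not> \<phi> (Y n m0) \<le> 0) sequentially"
  proof (rule ccontr)
    assume "\<not> ?thesis"
    from sub[OF this] obtain r :: "nat \<Rightarrow> nat" where r: "strict_mono r" "\<And>n. \<phi> (Y (r n) m0) \<le> 0" by blast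
    from lim[OF _ r(1), of "\<lambda>_. m0" m0 m0] obtain k y where
      "(\<lambda>n. \<phi> (Y (r (k n)) m0)) \<longlonglongrightarrow> \<phi> (y b)" "ode_solution (f m0) a b y0 y" by auto
    then show False using lo[of y] r(2) LIMSEQ_le_const2[of _ "\<phi> (y b)" 0] by force
  qed
  have ev1: "eventually (\<lambda>n. \<not> \<phi> (Y n m1) \<ge> 0) sequentially"
  proof (rule ccontr)
    assume "\<not> ?thesis"
    from sub[OF this] obtain r :: "nat \<Rightarrow> nat" where r: "strict_mono r" "\<And>n. \<phi> (Y (r n) m1) \<ge> 0" by blast
    from lim[OF _ r(1), of "\<lambda>_. m1" m1 m1] obtain k y where
      "(\<lambda>n. \<phi> (Y (r (k n)) m1)) \<longlonglongrightarrow> \<phi> (y b)" "ode_solution (f m1) a b y0 y" by auto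
    then show False using hi[of y] r(2) LIMSEQ_le_const[of _ "\<phi> (y b)" 0] by force
  qed
  obtain N where N: "\<And>n. n \<ge> N \<Longrightarrow> \<phi> (Y n m0) > 0 \<and> \<phi> (Y n m1) < 0"
    using eventually_conj[OF ev0 ev1] unfolding eventually_sequentially by force
  have Ycont: "continuous_on {m0..m1} (\<lambda>\<mu>. \<phi> (Y n \<mu>))" for n
  proof (rule continuous_on_compose2[OF \<phi>])
    show "continuous_on {m0..m1} (Y n)"
      unfolding continuous_on_sequentially comp_def Y_def
      using tonelli_tendsto_parameter[OF f bd] by blast
  qed auto
  \<comment> \<open>The shift by \<open>N\<close> keeps only step numbers at which the two ends have
    opposite signs. The parameters found may vary with \<open>n\<close>, which is why
    \<open>lim\<close> admits a sequence of parameters.\<close>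
  have "\<exists>\<mu>. \<mu> \<in> {m0..m1} \<and> \<phi> (Y (n + N) \<mu>) = 0" for n
    using IVT2'[of "\<lambda>\<mu>. \<phi> (Y (n + N) \<mu>)" m1 0 m0] N[of "n + N"] m Ycont by fastforce
  then obtain \<mu> where \<mu>: "\<And>n. \<mu> n \<in> {m0..m1}" "\<And>n. \<phi> (Y (n + N) (\<mu> n)) = 0" by metis
  have "strict_mono (\<lambda>n. n + N)" by (simp add: strict_mono_def)
  from lim[of \<mu>, OF \<mu>(1) this] obtain k \<nu> y where "\<nu> \<in> {m0..m1}" "ode_solution (f \<nu>) a b y0 y"
    "(\<lambda>n. \<phi> (Y (k n + N) (\<mu> (k n)))) \<longlonglongrightarrow> \<phi> (y b)" by blast
  moreover from this have "\<phi> (y b) = 0" using \<mu>(2) by (simp add: LIMSEQ_const_iff)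
  ultimately show ?thesis by blast
qed

section \<open>A priori estimates for radial profiles\<close>

lemma exp_growth_bound:
  fixes v :: "real \<Rightarrow> real"
  assumes "s \<le> t" and cont: "continuous_on {s..t} v"
    and der: "\<And>x. s < x \<Longrightarrow> x < t \<Longrightarrow> \<exists>v'. (v has_real_derivative v') (at x) \<and> v' \<le> c * v x"
  shows "v t \<le> exp (c * (t - s)) * v s"
proof -
  have "v t * exp (- c * t) \<le> v s * exp (- c * s)"
  proof (rule DERIV_nonpos_imp_decreasing_open[OF \<open>s \<le> t\<close>])
    fix x assume "s < x" "x < t"
    then obtain v' where v': "(v has_real_derivative v') (at x)" "v' \<le> c * v x" using der by blast
    have "((\<lambda>x. v x * exp (- c * x)) has_real_derivative (v' - c * v x) * exp (- c * x)) (at x)"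
      by (auto intro!: derivative_eq_intros v'(1) simp: algebra_simps)
    then show "\<exists>y. ((\<lambda>x. v x * exp (- c * x)) has_real_derivative y) (at x) \<and> y \<le> 0"
      using v'(2) by (meson diff_le_0_iff_le exp_ge_zero mult_nonpos_nonneg)
  qed (intro continuous_intros cont)
  then have *: "v t * exp (- c * t) * exp (c * t) \<le> v s * exp (- c * s) * exp (c * t)"
    by (intro mult_right_mono) auto
  have e1: "v t * exp (- c * t) * exp (c * t) = v t"
    by (simp add: mult.assoc flip: exp_add)
  have e2: "v s * exp (- c * s) * exp (c * t) = exp (c * (t - s)) * v s"
    by (simp add: mult.assoc algebra_simps flip: exp_add)
  show ?thesis using * unfolding e1 e2 .
qed

text \<open>The half of the flux equation that survives when the nonnegative source is dropped. It
  is one-sided: the source may push \<open>v\<close> down arbitrarily fast.\<close>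

definition growth_le :: "real \<Rightarrow> real \<Rightarrow> real \<Rightarrow> (real \<Rightarrow> real) \<Rightarrow> bool" where
  "growth_le D a b v \<longleftrightarrow> continuous_on {a..b} v \<and>
     (\<forall>x. a < x \<longrightarrow> x < b \<longrightarrow> (\<exists>v'. (v has_real_derivative v') (at x) \<and> v' \<le> D * \<bar>v x\<bar>))"

lemma growth_le_subinterval:
  "growth_le D a b v \<Longrightarrow> a \<le> s \<Longrightarrow> t \<le> b \<Longrightarrow> growth_le D s t v"
  unfolding growth_le_def by (auto elim!: continuous_on_subset)

text \<open>After the last time at which \<open>v\<close> is nonpositive,
  \<open>\<bar>v\<bar> = v\<close>, and Gronwall started at that time keeps \<open>v\<close> from
  becoming positive.\<close>

lemma growth_le_nonpos:
  assumes v: "growth_le D s t v" and "s \<le> t" and "v s \<le> 0"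
  shows "v t \<le> 0"
proof (rule ccontr)
  assume "\<not> v t \<le> 0"
  then have pos: "0 < v t" by simp
  have cont: "continuous_on {s..t} v" using v by (simp add: growth_le_def)
  define S where "S = {x \<in> {s..t}. v x \<le> 0}"
  have "closed S" unfolding S_def
    by (intro continuous_on_closed_Collect_le cont continuous_intros)
  moreover have bd: "bdd_above S" and ne: "S \<noteq> {}"
    using assms by (auto simp: S_def bdd_above_def)
  ultimately have "Sup S \<in> S" using closed_contains_Sup by blast
  then have \<sigma>: "s \<le> Sup S" "Sup S \<le> t" "v (Sup S) \<le> 0" by (auto simp: S_def)
  have "v t \<le> exp (D * (t - Sup S)) * v (Sup S)"
  proof (rule exp_growth_bound[OF \<sigma>(2)])
    show "continuous_on {Sup S..t} v" using cont \<sigma> by (auto elim: continuous_on_subset)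
    fix x assume x: "Sup S < x" "x < t"
    then have "x \<notin> S" using cSup_upper[OF _ bd] by force
    then have "0 < v x" using x \<sigma> by (auto simp: S_def)
    moreover obtain v' where "(v has_real_derivative v') (at x)" "v' \<le> D * \<bar>v x\<bar>"
      using v x \<sigma> unfolding growth_le_def by (meson order_le_less_trans)
    ultimately show "\<exists>v'. (v has_real_derivative v') (at x) \<and> v' \<le> D * v x" by auto
  qed
  also have "\<dots> \<le> 0" using \<sigma> by (simp add: mult_nonneg_nonpos)
  finally show False using pos by simp
qed

text \<open>Since \<open>v\<close> stays nonpositive, \<open>\<bar>v\<bar> = - v\<close>, and the
  inequality becomes linear. In particular a strictly negative flux stays strictly negative.\<close>

lemma growth_le_decay:
  assumes v: "growth_le D s t v" and "s \<le> t" and "v s \<le> 0"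
  shows "v t \<le> exp (- D * (t - s)) * v s"
proof (rule exp_growth_bound[OF \<open>s \<le> t\<close>])
  show "continuous_on {s..t} v" using v by (simp add: growth_le_def)
  fix x assume x: "s < x" "x < t"
  have "v x \<le> 0" using growth_le_nonpos[OF growth_le_subinterval[OF v, of s x]] x assms by auto
  then show "\<exists>v'. (v has_real_derivative v') (at x) \<and> v' \<le> - D * v x"
    using v x unfolding growth_le_def by fastforce
qed

text \<open>A negative value before \<open>t\<close> would persist up to \<open>t\<close> by
  \<open>growth_le_decay\<close>; so \<open>v\<close> is nonnegative throughout and Gronwall
  applies.\<close>

lemma growth_le_growth:
  assumes v: "growth_le D s t v" and "s \<le> t" and "0 \<le> v t"
  shows "v t \<le> exp (D * (t - s)) * v s"
proof (cases "\<exists>x\<in>{s..t}. v x < 0")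
  case True
  then obtain x where x: "x \<in> {s..t}" "v x < 0" by blast
  have "v t \<le> exp (- D * (t - x)) * v x"
    using growth_le_decay[OF growth_le_subinterval[OF v, of x t]] x by auto
  also have "\<dots> < 0" using x by (simp add: mult_pos_neg)
  finally show ?thesis using assms by simp
next
  case False
  show ?thesis
  proof (rule exp_growth_bound[OF \<open>s \<le> t\<close>])
    show "continuous_on {s..t} v" using v by (simp add: growth_le_def)
    fix x assume x: "s < x" "x < t"
    then have "0 \<le> v x" using False by (auto simp: not_less)
    then show "\<exists>v'. (v has_real_derivative v') (at x) \<and> v' \<le> D * v x"
      using v x unfolding growth_le_def by fastforce
  qed
qed

text \<open>The odd power sgn v |v|^q. As \<open>0 powr q = 0\<close>, the term of the wrong sign
  vanishes, and both bases are nonnegative, so continuity at 0 needs no case distinction.\<close>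

definition signed_powr :: "real \<Rightarrow> real \<Rightarrow> real" where
  "signed_powr q v = max v 0 powr q - max (- v) 0 powr q"

lemma signed_powr_nonneg: "0 \<le> v \<Longrightarrow> signed_powr q v = v powr q"
  and signed_powr_nonpos: "v \<le> 0 \<Longrightarrow> signed_powr q v = - ((- v) powr q)"
  by (auto simp: signed_powr_def)

lemma signed_powr_minus: "signed_powr q (- v) = - signed_powr q v"
  by (simp add: signed_powr_def)

lemma continuous_on_signed_powr [continuous_intros]:
  "continuous_on S f \<Longrightarrow> 0 < q \<Longrightarrow> continuous_on S (\<lambda>x. signed_powr q (f x))"
  unfolding signed_powr_def
  by (intro continuous_on_diff continuous_on_powr' continuous_on_max continuous_on_minus
      continuous_on_const) auto

text \<open>\<open>u\<close> is the radial profile and \<open>v\<close> is the flux \<open>\<bar>u'\<bar>\<^bsup>\<alpha>\<^esup> u'\<close>, so that \<open>q = 1 / (1 + \<alpha>)\<close>. All estimates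
  only use that the flux balances the source up to a term of order \<open>\<bar>v\<bar>\<close>.\<close>

definition profile :: "real \<Rightarrow> real \<Rightarrow> real \<Rightarrow> real \<Rightarrow> real \<Rightarrow> real \<Rightarrow> (real \<Rightarrow> real) \<Rightarrow> (real \<Rightarrow> real) \<Rightarrow> bool"
  where "profile q p D \<beta> a b u v \<longleftrightarrow> continuous_on {a..b} u \<and> continuous_on {a..b} v \<and>
    (\<forall>x. a < x \<longrightarrow> x < b \<longrightarrow> (u has_real_derivative signed_powr q (v x)) (at x) \<and>
      (\<exists>v'. (v has_real_derivative v') (at x) \<and> \<bar>v' + \<beta> * max (u x) 0 powr p\<bar> \<le> D * \<bar>v x\<bar>))"

section \<open>Positivity and monotonicity of profiles\<close>

lemma profile_growth_le:
  assumes "profile q p D \<beta> a b u v" "0 \<le> \<beta>"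
  shows "growth_le D a b v"
  unfolding growth_le_def
proof (intro conjI allI impI)
  fix x assume "a < x" "x < b"
  with assms obtain v' where v': "(v has_real_derivative v') (at x)"
    "\<bar>v' + \<beta> * max (u x) 0 powr p\<bar> \<le> D * \<bar>v x\<bar>" unfolding profile_def by blast
  moreover have "0 \<le> \<beta> * max (u x) 0 powr p" using assms by simp
  ultimately show "\<exists>v'. (v has_real_derivative v') (at x) \<and> v' \<le> D * \<bar>v x\<bar>"
    by (intro exI[of _ v']) linarith
qed (use assms in \<open>simp add: profile_def\<close>)

lemma profile_mvt:
  assumes P: "profile q p D \<beta> a b u v" and "a \<le> s" "s < t" "t \<le> b"
  obtains z where "s < z" "z < t" "u t - u s = (t - s) * signed_powr q (v z)"
proof -
  have "continuous_on {s..t} u" using P assms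
    by (auto simp: profile_def elim: continuous_on_subset)
  moreover have "(u has_real_derivative signed_powr q (v x)) (at x)" if "s < x" "x < t" for x
    using P assms that by (auto simp: profile_def)
  ultimately obtain l z where z: "s < z" "z < t" "(u has_real_derivative l) (at z)"
    "u t - u s = (t - s) * l"
    using MVT[OF \<open>s < t\<close>, of u] by (metis real_differentiable_def)
  moreover have "(u has_real_derivative signed_powr q (v z)) (at z)"
    using P assms z by (auto simp: profile_def)
  ultimately have "l = signed_powr q (v z)" using DERIV_unique by blast
  then show ?thesis using that z by blast
qed

text \<open>Reversing the interval flips the sign of the flux but not of its derivative, and the
  error bound depends on \<open>\<bar>v\<bar>\<close> only. A maximum in the right half is thus
  reduced to one in the left half.\<close>

lemma profile_reflect:
  assumes P: "profile q p D \<beta> a b u v"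
  shows "profile q p D \<beta> a b (\<lambda>x. u (a + b - x)) (\<lambda>x. - v (a + b - x))"
  unfolding profile_def
proof (intro conjI allI impI)
  have im: "(\<lambda>x. a + b - x) ` {a..b} \<subseteq> {a..b}" by auto
  have c: "continuous_on {a..b} (\<lambda>x. a + b - x)" by (intro continuous_intros)
  show "continuous_on {a..b} (\<lambda>x. u (a + b - x))" "continuous_on {a..b} (\<lambda>x. - v (a + b - x))"
    using P unfolding profile_def
    by (auto intro!: continuous_on_minus continuous_on_compose2[OF _ c im])
  fix x assume "a < x" "x < b"
  then have y: "a < a + b - x" "a + b - x < b" by auto
  obtain v' where v': "(v has_real_derivative v') (at (a + b - x))"
    "\<bar>v' + \<beta> * max (u (a + b - x)) 0 powr p\<bar> \<le> D * \<bar>v (a + b - x)\<bar>"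
    and u': "(u has_real_derivative signed_powr q (v (a + b - x))) (at (a + b - x))"
    using P y unfolding profile_def by blast
  have l: "((\<lambda>x. a + b - x) has_real_derivative - 1) (at x)" by (auto intro!: derivative_eq_intros)
  show "((\<lambda>x. u (a + b - x)) has_real_derivative signed_powr q (- v (a + b - x))) (at x)"
    using DERIV_chain2[OF u' l] by (simp add: signed_powr_minus)
  have "((\<lambda>x. - v (a + b - x)) has_real_derivative v') (at x)"
    using DERIV_minus[OF DERIV_chain2[OF v'(1) l]] by simp
  then show "\<exists>v'. ((\<lambda>x. - v (a + b - x)) has_real_derivative v') (at x) \<and>
      \<bar>v' + \<beta> * max (u (a + b - x)) 0 powr p\<bar> \<le> D * \<bar>- v (a + b - x)\<bar>"
    using v'(2) by auto
qed

text \<open>The profile first rises because \<open>v a > 0\<close>. If it came down to a nonpositive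
  value, the flux would be negative somewhere on the way; it would stay negative, and
  \<open>u\<close> would end strictly below 0.\<close>

lemma profile_pos:
  assumes P: "profile q p D \<beta> a b u v" and "0 \<le> \<beta>" "0 < q"
    and "u a = 0" "0 < v a" "0 \<le> u b" and x: "a < x" "x < b"
  shows "0 < u x"
proof (rule ccontr)
  assume "\<not> 0 < u x"
  then have ux: "u x \<le> 0" by simp
  have gr: "growth_le D a b v" using profile_growth_le[OF P] assms by blast
  have "continuous_on {a..b} v" using P by (simp add: profile_def)
  then have "\<exists>d>0. \<forall>y\<in>{a..b}. dist y a < d \<longrightarrow> dist (v y) (v a) < v a"
    using assms unfolding continuous_on_iff by force
  then obtain d where d: "d > 0" "\<And>y. y \<in> {a..b} \<Longrightarrow> \<bar>y - a\<bar> < d \<Longrightarrow> \<bar>v y - v a\<bar> < v a"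
    by (auto simp: dist_real_def)
  define x1 where "x1 = min (a + d / 2) ((a + x) / 2)"
  have x1: "a < x1" "x1 < x" "x1 - a < d" using d x by (auto simp: x1_def min_def field_simps)
  obtain z where z: "a < z" "z < x1" "u x1 - u a = (x1 - a) * signed_powr q (v z)"
    using profile_mvt[OF P, of a x1] x1 x by auto
  have "v z > 0" using d(2)[of z] z x1 x by auto
  then have ux1: "0 < u x1" using z x1 assms by (simp add: signed_powr_nonneg)
  obtain \<tau> where t: "x1 < \<tau>" "\<tau> < x" "u x - u x1 = (x - x1) * signed_powr q (v \<tau>)"
    using profile_mvt[OF P, of x1 x] x1 x by auto
  have "v \<tau> < 0"
  proof (rule ccontr)
    assume "\<not> v \<tau> < 0"
    then have "0 \<le> (x - x1) * signed_powr q (v \<tau>)" using x1 by (simp add: signed_powr_nonneg)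
    then show False using t ux ux1 by linarith
  qed
  obtain w where w: "x < w" "w < b" "u b - u x = (b - x) * signed_powr q (v w)"
    using profile_mvt[OF P, of x b] x by auto
  have "v w \<le> exp (- D * (w - \<tau>)) * v \<tau>"
    using growth_le_decay[OF growth_le_subinterval[OF gr, of \<tau> w]] w t x1 x \<open>v \<tau> < 0\<close> by auto
  also have "\<dots> < 0" using \<open>v \<tau> < 0\<close> by (simp add: mult_pos_neg)
  finally have "(b - x) * signed_powr q (v w) < 0"
    using x by (simp add: signed_powr_nonpos mult_pos_neg)
  then show False using w ux assms by linarith
qed

text \<open>Without source the inequality is two-sided, so \<open>growth_le\<close> also holds for
  \<open>- v\<close>. Its negative initial value persists, which means that \<open>v\<close> stays
  positive and \<open>u\<close> increases.\<close>

lemma profile_no_source_pos: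
  assumes P: "profile q p D 0 a b u v" and "a < b" "0 < q" "u a = 0" "0 < v a"
  shows "0 < u b"
proof -
  have gr: "growth_le D a b (\<lambda>x. - v x)"
    unfolding growth_le_def
  proof (intro conjI allI impI)
    show "continuous_on {a..b} (\<lambda>x. - v x)" using P by (auto simp: profile_def intro: continuous_on_minus)
    fix x assume "a < x" "x < b"
    with P obtain v' where v': "(v has_real_derivative v') (at x)" "\<bar>v'\<bar> \<le> D * \<bar>v x\<bar>"
      unfolding profile_def by auto
    then show "\<exists>v'. ((\<lambda>x. - v x) has_real_derivative v') (at x) \<and> v' \<le> D * \<bar>- v x\<bar>"
      by (intro exI[of _ "- v'"]) (auto intro: DERIV_minus)
  qed
  obtain z where z: "a < z" "z < b" "u b - u a = (b - a) * signed_powr q (v z)"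
    using profile_mvt[OF P, of a b] assms by auto
  have "v z > 0"
  proof (rule ccontr)
    assume "\<not> v z > 0"
    then have "- v z \<le> exp (D * (z - a)) * - v a"
      using growth_le_growth[OF growth_le_subinterval[OF gr, of a z]] z by auto
    also have "\<dots> < 0" using assms by (simp add: mult_pos_neg)
    finally show False using \<open>\<not> v z > 0\<close> by simp
  qed
  then show ?thesis using z assms by (simp add: signed_powr_nonneg)
qed

text \<open>To the right of its maximum the profile is concave up to exponential factors: the downward flux
  can only decrease at the rate \<open>D\<close>. Hence it stays comparable to the maximum on a long interval, over
  which the source accumulates flux.\<close>

lemma profile_source_bound_right:
  assumes P: "profile q p D \<beta> a b u v" and "0 \<le> \<beta>" "0 < q" "0 \<le> D" "0 \<le> p"
    and nonneg: "\<And>x. x \<in> {a..b} \<Longrightarrow> 0 \<le> u x"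
    and r: "a \<le> r" "r \<le> (a + b) / 2" "v r \<le> 0" and "a < b"
  defines "\<kappa> \<equiv> exp (D * (b - a))" and "l \<equiv> (b - a) / 4"
  defines "K \<equiv> 1 + 4 * \<kappa> powr (2 * q)"
  shows "\<beta> * u r powr p \<le> K powr p * \<kappa>\<^sup>2 * l powr (- 1 - 1 / q) * u r powr (1 / q)"
proof -
  \<comment> \<open>The right half is cut into two pieces of length \<open>l\<close>: on
    \<open>{m..s}\<close> the source accumulates downward flux, and on \<open>{s..b}\<close> the
    flux present at \<open>s\<close> is converted into height of \<open>u\<close>.\<close>
  define m where "m = (a + b) / 2"
  define s where "s = b - l"
  have ord: "r \<le> m" "m < s" "s < b" "a < m" "s - m = l" "b - s = l" "0 < l"
    using r \<open>a < b\<close> by (auto simp: m_def s_def l_def field_simps)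
  have \<kappa>: "1 \<le> \<kappa>" using assms by (simp add: \<kappa>_def)
  have gr: "growth_le D a b v" using profile_growth_le[OF P] assms by blast
  have nonpos: "v t \<le> 0" if "r \<le> t" "t \<le> b" for t
    using growth_le_nonpos[OF growth_le_subinterval[OF gr, of r t]] that r by auto
  have decay: "- v t \<le> \<kappa> * - v t'" if "r \<le> t" "t \<le> t'" "t' \<le> b" for t t'
  proof -
    have "v t' \<le> exp (- D * (t' - t)) * v t"
      using growth_le_decay[OF growth_le_subinterval[OF gr, of t t']] nonpos that r by auto
    then have "exp (D * (t' - t)) * v t' \<le> exp (D * (t' - t)) * (exp (- D * (t' - t)) * v t)"
      by (intro mult_left_mono) auto
    also have "\<dots> = v t" by (simp flip: mult.assoc exp_add)
    finally have "- v t \<le> exp (D * (t' - t)) * - v t'" by simp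
    also have "\<dots> \<le> \<kappa> * - v t'"
    proof (rule mult_right_mono)
      have "D * (t' - t) \<le> D * (b - a)" using assms that by (intro mult_left_mono) auto
      then show "exp (D * (t' - t)) \<le> \<kappa>" by (simp add: \<kappa>_def)
    qed (use nonpos that in auto)
    finally show ?thesis .
  qed
  define w where "w = - v s"
  have w: "0 \<le> w" using nonpos[of s] ord by (simp add: w_def)
  \<comment> \<open>On \<open>{s..b}\<close> the downward flux is at least
    \<open>w / \<kappa>\<close>, and \<open>u\<close> must not fall below 0 before \<open>b\<close>;
    so it starts from at least this height.\<close>
  have us: "l * (w / \<kappa>) powr q \<le> u s"
  proof -
    obtain z where z: "s < z" "z < b" "u b - u s = (b - s) * signed_powr q (v z)"
      using profile_mvt[OF P, of s b] ord by auto
    have vz: "v z \<le> 0" using nonpos z ord by auto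
    have "w / \<kappa> \<le> - v z" using decay[of s z] z ord \<kappa> by (simp add: w_def field_simps)
    then have "(w / \<kappa>) powr q \<le> (- v z) powr q" using w \<kappa> assms by (intro powr_mono2) auto
    then have "l * (w / \<kappa>) powr q \<le> l * (- v z) powr q" using ord by (intro mult_left_mono) auto
    also have "\<dots> = u s - u b" using z ord vz by (simp add: signed_powr_nonpos)
    finally show ?thesis using nonneg[of b] \<open>a < b\<close> by simp
  qed
  have mono: "u t' \<le> u t" if tt: "r \<le> t" "t \<le> t'" "t' \<le> b" for t t'
  proof (cases "t = t'")
    case False
    then obtain z where z: "t < z" "z < t'" "u t' - u t = (t' - t) * signed_powr q (v z)"
      using profile_mvt[OF P, of t t'] tt r by auto
    have "v z \<le> 0" using nonpos z tt by auto
    then have "(t' - t) * signed_powr q (v z) \<le> 0" using tt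
      by (simp add: signed_powr_nonpos mult_nonneg_nonpos)
    then show ?thesis using z by simp
  qed simp
  \<comment> \<open>The downward flux between \<open>r\<close> and \<open>s\<close> is at most
    \<open>\<kappa> * w\<close> and the length at most \<open>4 * l\<close>. Writing
    \<open>\<kappa> * w\<close> as \<open>\<kappa>\<^sup>2 * (w / \<kappa>)\<close> makes the drop a
    multiple of the quantity bounded in \<open>us\<close>.\<close>
  have ur: "u r \<le> K * u s"
  proof -
    obtain z where z: "r < z" "z < s" "u s - u r = (s - r) * signed_powr q (v z)"
      using profile_mvt[OF P, of r s] ord r by auto
    have vz: "v z \<le> 0" using nonpos z ord by auto
    have "- v z \<le> \<kappa>\<^sup>2 * (w / \<kappa>)"
      using decay[of z s] z ord \<kappa> by (simp add: w_def field_simps power2_eq_square)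
    then have "(- v z) powr q \<le> (\<kappa>\<^sup>2 * (w / \<kappa>)) powr q" using vz assms by (intro powr_mono2) auto
    also have "\<dots> = \<kappa> powr (2 * q) * (w / \<kappa>) powr q"
      using \<kappa> w by (subst powr_mult) (auto simp: powr_powr[symmetric] powr_numeral)
    finally have "(s - r) * (- v z) powr q \<le> (4 * l) * (\<kappa> powr (2 * q) * (w / \<kappa>) powr q)"
      using z ord r by (intro mult_mono) (auto simp: l_def)
    also have "\<dots> = 4 * \<kappa> powr (2 * q) * (l * (w / \<kappa>) powr q)" by simp
    also have "\<dots> \<le> 4 * \<kappa> powr (2 * q) * u s" using us by (intro mult_left_mono) auto
    finally have "u r - u s \<le> 4 * \<kappa> powr (2 * q) * u s" using z vz by (simp add: signed_powr_nonpos)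
    then show ?thesis by (simp add: K_def algebra_simps)
  qed
  have us0: "0 \<le> u s" using nonneg[of s] ord by auto
  \<comment> \<open>As \<open>v \<le> 0\<close> here, the error \<open>D * \<bar>v x\<bar>\<close>
    equals \<open>- D * v x\<close> and is absorbed by the integrating factor
    \<open>exp (D * x)\<close>. On \<open>{m..s}\<close> the source is at least its value at
    \<open>s\<close>, because \<open>u\<close> decreases.\<close>
  have flux: "l * (\<beta> * u s powr p) \<le> \<kappa> * w"
  proof -
    let ?g = "\<lambda>x. v x * exp (D * x)"
    have cont: "continuous_on {m..s} ?g"
      using P ord by (auto simp: profile_def intro!: continuous_intros elim: continuous_on_subset)
    have d: "\<exists>v'. (v has_real_derivative v') (at x) \<and> \<bar>v' + \<beta> * max (u x) 0 powr p\<bar> \<le> D * \<bar>v x\<bar>"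
      if "m < x" "x < s" for x using P that ord unfolding profile_def by force
    have d': "\<exists>v'. (?g has_real_derivative (v' + D * v x) * exp (D * x)) (at x) \<and>
        \<bar>v' + \<beta> * max (u x) 0 powr p\<bar> \<le> D * \<bar>v x\<bar>" if x: "m < x" "x < s" for x
    proof -
      obtain v' where v': "(v has_real_derivative v') (at x)"
        "\<bar>v' + \<beta> * max (u x) 0 powr p\<bar> \<le> D * \<bar>v x\<bar>" using d[OF x] by blast
      have "(?g has_real_derivative (v' + D * v x) * exp (D * x)) (at x)"
        by (auto intro!: derivative_eq_intros v'(1) simp: algebra_simps)
      then show ?thesis using v'(2) by blast
    qed
    have "?g differentiable (at x)" if "m < x" "x < s" for x
      using d'[OF that] real_differentiable_def by blast
    from MVT[OF ord(2) cont this] obtain y z where z: "m < z" "z < s"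
      "(?g has_real_derivative y) (at z)" "?g s - ?g m = (s - m) * y" by blast
    obtain v' where v': "(?g has_real_derivative (v' + D * v z) * exp (D * z)) (at z)"
      "\<bar>v' + \<beta> * max (u z) 0 powr p\<bar> \<le> D * \<bar>v z\<bar>" using d' z by blast
    have y: "y = (v' + D * v z) * exp (D * z)" using DERIV_unique z v' by blast
    have vz: "v z \<le> 0" using nonpos z ord by auto
    have "u s powr p \<le> max (u z) 0 powr p"
      using mono[of z s] z ord us0 assms by (intro powr_mono2) auto
    then have "\<beta> * u s powr p \<le> \<beta> * max (u z) 0 powr p" using assms by (intro mult_left_mono)
    then have B: "v' + D * v z \<le> - (\<beta> * u s powr p)" using v'(2) vz by (auto simp: abs_if split: if_splits)
    have "?g s \<le> ?g s - ?g m" using nonpos[of m] ord by (simp add: mult_nonpos_nonneg)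
    also have "\<dots> = l * exp (D * z) * (v' + D * v z)" using z(4) y ord by simp
    also have "\<dots> \<le> l * exp (D * z) * - (\<beta> * u s powr p)"
      using B ord by (intro mult_left_mono) auto
    finally have "l * (\<beta> * u s powr p) * exp (D * z) \<le> w * exp (D * s)"
      by (simp add: w_def algebra_simps)
    then have *: "l * (\<beta> * u s powr p) * exp (D * z) * exp (- D * z) \<le> w * exp (D * s) * exp (- D * z)"
      by (rule mult_right_mono) simp
    have e: "exp (D * z) * exp (- D * z) = 1" "exp (D * s) * exp (- D * z) = exp (D * (s - z))"
      by (simp_all add: algebra_simps flip: exp_add)
    have "l * (\<beta> * u s powr p) \<le> w * exp (D * (s - z))" using * unfolding mult.assoc e by simp
    also have "\<dots> \<le> w * \<kappa>"
      using z ord w assms unfolding \<kappa>_def by (intro mult_left_mono) (auto intro!: mult_left_mono)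
    finally show ?thesis by (simp add: mult.commute)
  qed
  \<comment> \<open>Inverting \<open>us\<close> bounds the flux by a power of the height; inserted
    into \<open>flux\<close>, this eliminates \<open>w\<close>.\<close>
  have wus: "w / \<kappa> \<le> (u s / l) powr (1 / q)"
  proof -
    have "(w / \<kappa>) powr q \<le> u s / l" using us ord by (simp add: field_simps)
    then have "((w / \<kappa>) powr q) powr (1 / q) \<le> (u s / l) powr (1 / q)"
      using assms by (intro powr_mono2) auto
    then show ?thesis using w \<kappa> assms by (simp add: powr_powr)
  qed
  have "l * (\<beta> * u s powr p) \<le> \<kappa>\<^sup>2 * (w / \<kappa>)"
    using flux \<kappa> by (simp add: power2_eq_square)
  also have "\<dots> \<le> \<kappa>\<^sup>2 * (u s / l) powr (1 / q)" using wus by (intro mult_left_mono) auto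
  also have "\<dots> \<le> \<kappa>\<^sup>2 * (u r / l) powr (1 / q)"
    using mono[of r s] ord us0 assms
    by (intro mult_left_mono powr_mono2 divide_right_mono) auto
  also have "\<dots> = l * (\<kappa>\<^sup>2 * l powr (- 1 - 1 / q) * u r powr (1 / q))"
    using ord nonneg[of r] r \<open>a < b\<close>
    by (simp add: powr_divide powr_diff powr_minus field_simps)
  finally have *: "\<beta> * u s powr p \<le> \<kappa>\<^sup>2 * l powr (- 1 - 1 / q) * u r powr (1 / q)"
    using ord by simp
  have K: "0 \<le> K" by (simp add: K_def)
  have "\<beta> * u r powr p \<le> \<beta> * (K * u s) powr p"
    using ur nonneg[of r] r \<open>a < b\<close> assms by (intro mult_left_mono powr_mono2) auto
  also have "\<dots> = K powr p * (\<beta> * u s powr p)" using K us0 by (simp add: powr_mult)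
  also have "\<dots> \<le> K powr p * (\<kappa>\<^sup>2 * l powr (- 1 - 1 / q) * u r powr (1 / q))"
    using * by (intro mult_left_mono) auto
  finally show ?thesis by (simp add: mult.assoc)
qed

text \<open>Comparison with an explicit barrier: the \<open>z\<close> below satisfies z' \<le> - D z
  - E and \<open>z a = 1\<close>, whereas v' \<ge> - D |v| - E. Since
  \<open>\<bar>v\<bar> \<le> \<bar>z - v\<bar> + z\<close>, the difference \<open>z - v\<close>
  satisfies \<open>growth_le\<close> and cannot become positive. The smallness condition keeps the
  linear factor of \<open>z\<close> above 1/2.\<close>

lemma profile_flux_lower_bound:
  assumes P: "profile q p D \<beta> a b u v" and "0 \<le> \<beta>" "0 \<le> D" "0 \<le> p" and va: "v a = 1" and "0 \<le> E"
    and bd: "\<And>x. x \<in> {a..b} \<Longrightarrow> \<beta> * max (u x) 0 powr p \<le> E"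
    and small: "2 * E * exp (D * (b - a)) * (b - a) \<le> 1" and t: "t \<in> {a..b}"
  shows "exp (- D * (b - a)) / 2 \<le> v t"
proof -
  let ?\<kappa> = "exp (D * (b - a))"
  define z where "z x = exp (- D * (x - a)) * (1 - E * ?\<kappa> * (x - a))" for x
  have z: "1 / 2 \<le> 1 - E * ?\<kappa> * (x - a)" if "x \<in> {a..b}" for x
  proof -
    have "E * ?\<kappa> * (x - a) \<le> E * ?\<kappa> * (b - a)" using that assms by (intro mult_left_mono) auto
    then show ?thesis using small by (simp add: field_simps)
  qed
  have "growth_le D a b (\<lambda>x. z x - v x)"
    unfolding growth_le_def
  proof (intro conjI allI impI)
    show "continuous_on {a..b} (\<lambda>x. z x - v x)"
      using P unfolding profile_def z_def by (intro continuous_intros) auto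
    fix x assume x: "a < x" "x < b"
    then obtain v' where v': "(v has_real_derivative v') (at x)"
      "\<bar>v' + \<beta> * max (u x) 0 powr p\<bar> \<le> D * \<bar>v x\<bar>" using P unfolding profile_def by blast
    define e where "e = exp (- D * (x - a))"
    have zd: "(z has_real_derivative - D * z x - E * ?\<kappa> * e) (at x)"
      unfolding z_def e_def by (auto intro!: derivative_eq_intros simp: algebra_simps)
    have "D * (x - a) \<le> D * (b - a)" using x assms by (intro mult_left_mono) auto
    then have "1 \<le> ?\<kappa> * e" unfolding e_def by (simp flip: exp_add)
    then have "E * 1 \<le> E * (?\<kappa> * e)" using assms by (intro mult_left_mono)
    then have e: "E \<le> E * ?\<kappa> * e" by (simp add: mult.assoc)
    have z0: "0 \<le> z x" using z[of x] x by (auto simp: z_def)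
    have "\<bar>v x\<bar> \<le> \<bar>z x - v x\<bar> + z x" using z0 by arith
    then have "D * \<bar>v x\<bar> \<le> D * \<bar>z x - v x\<bar> + D * z x"
      using assms by (metis distrib_left mult_left_mono)
    then have "- D * z x - E * ?\<kappa> * e - v' \<le> D * \<bar>z x - v x\<bar>"
      using v'(2) bd[of x] x e by (auto simp: abs_le_iff)
    then show "\<exists>y. ((\<lambda>x. z x - v x) has_real_derivative y) (at x) \<and> y \<le> D * \<bar>z x - v x\<bar>"
      using DERIV_diff[OF zd v'(1)] by blast
  qed
  from growth_le_nonpos[OF growth_le_subinterval[OF this, of a t]]
  have "z t \<le> v t" using t va by (auto simp: z_def)
  moreover have "exp (- D * (b - a)) * (1 / 2) \<le> z t"
    unfolding z_def using z[OF t] t assms by (intro mult_mono) (auto intro!: mult_left_mono)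
  ultimately show ?thesis by simp
qed

text \<open>Superlinearity \<open>1 / q < p\<close> enters here: it turns the scale-invariant bound of the previous lemmas
  and a lower bound for the maximum into a bound for the strength of the source.\<close>

lemma profile_source_bound:
  assumes "0 < q" "1 / q < p" "0 \<le> D" "a < b"
  obtains B where "\<And>\<beta> u v. 0 \<le> \<beta> \<Longrightarrow> profile q p D \<beta> a b u v \<Longrightarrow> u a = 0 \<Longrightarrow> v a = 1 \<Longrightarrow> 0 \<le> u b \<Longrightarrow> \<beta> \<le> B"
proof -
  define \<kappa> where "\<kappa> = exp (D * (b - a))"
  define l where "l = (b - a) / 4"
  define K where "K = 1 + 4 * \<kappa> powr (2 * q)"
  define C where "C = K powr p * \<kappa>\<^sup>2 * l powr (- 1 - 1 / q)"
  \<comment> \<open>Two lower bounds for the maximum: \<open>M1\<close> is the height climbed at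
    flux \<open>1 / (2 * \<kappa>)\<close> over the whole interval, and \<open>M2\<close> comes from
    the scale-invariant bound when the source is not small.\<close>
  define M1 where "M1 = (b - a) * (1 / (2 * \<kappa>)) powr q"
  define M2 where "M2 = (1 / (2 * \<kappa> * (b - a) * C)) powr q"
  define M0 where "M0 = min M1 M2"
  have \<kappa>: "0 < \<kappa>" by (simp add: \<kappa>_def)
  have "0 < K" by (simp add: K_def add_pos_nonneg)
  then have C: "0 < C" using assms \<kappa> by (simp add: C_def l_def)
  have M0: "0 < M0" using assms \<kappa> C by (simp add: M0_def M1_def M2_def)
  have p: "0 < p" using assms by (meson divide_pos_pos less_trans zero_less_one)
  have "\<beta> \<le> C * M0 powr (1 / q - p)"
    if \<beta>: "0 \<le> \<beta>" and P: "profile q p D \<beta> a b u v" and ua: "u a = 0" and va: "v a = 1" and ub: "0 \<le> u b"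
    for \<beta> u v
  proof -
    have pos: "0 < u x" if "a < x" "x < b" for x
      using profile_pos[OF P \<beta> assms(1) ua _ ub that] va by simp
    have nonneg: "0 \<le> u x" if "x \<in> {a..b}" for x
      using pos[of x] ua ub that by (cases "x = a"; cases "x = b") auto
    have "continuous_on {a..b} u" using P by (simp add: profile_def)
    then obtain r where r: "r \<in> {a..b}" "\<And>x. x \<in> {a..b} \<Longrightarrow> u x \<le> u r"
      using continuous_attains_sup[of "{a..b}" u] assms by auto
    have "0 < u ((a + b) / 2)" using pos assms by (simp add: field_simps)
    then have ur: "0 < u r" using r(2)[of "(a + b) / 2"] assms by (simp add: field_simps)
    have vr: "v r = 0" if "r < b"
    proof -
      have ar: "a < r" using ua ur r by (cases "r = a") auto
      have "(u has_real_derivative signed_powr q (v r)) (at r)" using P ar that by (simp add: profile_def)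
      moreover have "\<forall>y. \<bar>r - y\<bar> < min (r - a) (b - r) \<longrightarrow> u y \<le> u r"
        using r(2) by (auto simp: abs_if split: if_splits)
      moreover have "0 < min (r - a) (b - r)" using ar that by simp
      ultimately have "signed_powr q (v r) = 0" using DERIV_local_max by blast
      then show ?thesis by (auto simp: signed_powr_def max_def split: if_splits)
    qed
    \<comment> \<open>At a maximum located at the right end the flux need not vanish, but a negative
      flux would make \<open>u\<close> larger just before \<open>b\<close>. After reflection this is
      the sign required at the left end.\<close>
    have vr0: "0 \<le> v r" if "r = b"
    proof (rule ccontr)
      assume neg: "\<not> 0 \<le> v r"
      have "continuous_on {a..b} v" using P by (simp add: profile_def)
      then have "\<exists>d>0. \<forall>y\<in>{a..b}. dist y b < d \<longrightarrow> dist (v y) (v b) < - v b"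
        using assms neg that unfolding continuous_on_iff by force
      then obtain d where d: "d > 0" "\<And>y. y \<in> {a..b} \<Longrightarrow> \<bar>y - b\<bar> < d \<Longrightarrow> \<bar>v y - v b\<bar> < - v b"
        by (auto simp: dist_real_def)
      define x where "x = max a (b - d / 2)"
      have x: "a \<le> x" "x < b" "b - x < d" using d assms by (auto simp: x_def max_def)
      obtain y where y: "x < y" "y < b" "u b - u x = (b - x) * signed_powr q (v y)"
        using profile_mvt[OF P, of x b] x by auto
      have "v y < 0" using d(2)[of y] y x by auto
      then have "u b < u x" using y x
        by (smt (verit) mult_pos_neg signed_powr_nonpos powr_gt_zero)
      then show False using r(2)[of x] x that by auto
    qed
    have scale: "\<beta> * u r powr p \<le> C * u r powr (1 / q)"
    proof (cases "r \<le> (a + b) / 2")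
      case True
      then have "r < b" using assms by (simp add: field_simps)
      then show ?thesis
        using profile_source_bound_right[OF P \<beta> _ _ _ nonneg _ True] vr r assms p
        by (simp add: C_def K_def l_def \<kappa>_def)
    next
      case False
      have "0 \<le> v r" using vr vr0 r by (cases "r = b") auto
      then show ?thesis
        using profile_source_bound_right[OF profile_reflect[OF P] \<beta>, of "a + b - r"] r False assms p nonneg
        by (simp add: C_def K_def l_def \<kappa>_def)
    qed
    \<comment> \<open>The alternative is whether the source at its strongest can consume half of the
      initial flux.\<close>
    have "M0 \<le> u r"
    proof (cases "2 * (\<beta> * u r powr p) * \<kappa> * (b - a) \<le> 1")
      case True
      have "\<beta> * max (u x) 0 powr p \<le> \<beta> * u r powr p" if "x \<in> {a..b}" for x
        using r(2)[OF that] nonneg[OF that] \<beta> p by (intro mult_left_mono powr_mono2) auto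
      from profile_flux_lower_bound[OF P \<beta> _ _ va _ this] True \<beta> p assms
      have v: "exp (- D * (b - a)) / 2 \<le> v x" if "x \<in> {a..b}" for x
        using that by (simp add: \<kappa>_def)
      have v: "1 / (2 * \<kappa>) \<le> v x" if "x \<in> {a..b}" for x
      proof -
        have "1 / (2 * \<kappa>) = exp (- D * (b - a)) / 2" by (simp add: \<kappa>_def exp_minus inverse_eq_divide)
        then show ?thesis using v[OF that] by simp
      qed
      obtain z where z: "a < z" "z < b" "u b - u a = (b - a) * signed_powr q (v z)"
        using profile_mvt[OF P, of a b] assms by auto
      have vz: "1 / (2 * \<kappa>) \<le> v z" using v z by simp
      then have vz0: "0 \<le> v z" using \<kappa> by (meson divide_nonneg_pos mult_pos_pos order_trans zero_less_numeral zero_le_one)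
      have "M1 \<le> (b - a) * v z powr q" unfolding M1_def
        using vz assms \<kappa> by (intro mult_left_mono powr_mono2) auto
      then show ?thesis using z vz0 ua r(2)[of b] assms by (simp add: M0_def signed_powr_nonneg)
    next
      case False
      have "1 < 2 * (\<beta> * u r powr p) * \<kappa> * (b - a)" using False by simp
      also have "\<dots> \<le> 2 * (C * u r powr (1 / q)) * \<kappa> * (b - a)"
        using scale \<kappa> assms by (intro mult_right_mono mult_left_mono) auto
      finally have "1 / (2 * \<kappa> * (b - a) * C) \<le> u r powr (1 / q)"
        using C \<kappa> assms by (simp add: field_simps)
      then have "M2 \<le> (u r powr (1 / q)) powr q" unfolding M2_def
        using C \<kappa> assms by (intro powr_mono2) auto
      then show ?thesis using assms ur by (simp add: powr_powr M0_def)
    qed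
    have "\<beta> = \<beta> * u r powr p * u r powr (- p)" using ur by (simp add: powr_minus)
    also have "\<dots> \<le> C * u r powr (1 / q) * u r powr (- p)" using scale by (intro mult_right_mono) auto
    also have "\<dots> = C * u r powr (1 / q - p)" by (simp add: powr_add[symmetric] mult.assoc)
    also have "\<dots> \<le> C * M0 powr (1 / q - p)"
      using \<open>M0 \<le> u r\<close> M0 C assms by (intro mult_left_mono powr_mono2') auto
    finally show ?thesis .
  qed
  then show ?thesis using that by blast
qed

section \<open>Existence of a positive profile\<close>

lemma abs_signed_powr: "\<bar>signed_powr q v\<bar> = \<bar>v\<bar> powr q"
  by (cases "0 \<le> v") (simp_all add: signed_powr_nonneg signed_powr_nonpos)

lemma ode_solution_DERIV:
  assumes "ode_solution f a b y0 y" "a < x" "x < b"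
  shows "((\<lambda>x. fst (y x)) has_real_derivative fst (f x (y x))) (at x)"
    and "((\<lambda>x. snd (y x)) has_real_derivative snd (f x (y x))) (at x)"
proof -
  have "(y has_vector_derivative f x (y x)) (at x within {a..b})"
    using assms unfolding ode_solution_def by auto
  then have "(y has_vector_derivative f x (y x)) (at x)"
    using at_within_Icc_at[OF assms(2,3)] by simp
  from bounded_linear.has_vector_derivative[OF bounded_linear_fst this]
    bounded_linear.has_vector_derivative[OF bounded_linear_snd this]
  show "((\<lambda>x. fst (y x)) has_real_derivative fst (f x (y x))) (at x)"
    and "((\<lambda>x. snd (y x)) has_real_derivative snd (f x (y x))) (at x)"
    by (simp_all add: has_real_derivative_iff_has_vector_derivative)
qed

text \<open>The differentiable quantity \<open>v\<^sup>2 + 1\<close> replaces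
  \<open>\<bar>v\<bar>\<close>; by \<open>2 * \<bar>v\<bar> \<le> v\<^sup>2 + 1\<close> the constant
  \<open>E\<close> is absorbed into the exponential rate.\<close>

lemma quadratic_growth_bound:
  assumes "s \<le> t" and cont: "continuous_on {s..t} v" and "0 \<le> D" "0 \<le> E"
    and der: "\<And>x. s < x \<Longrightarrow> x < t \<Longrightarrow>
      \<exists>v'. (v has_real_derivative v') (at x) \<and> \<bar>v'\<bar> \<le> D * \<bar>v x\<bar> + E"
  shows "(v t)\<^sup>2 + 1 \<le> exp ((2 * D + E) * (t - s)) * ((v s)\<^sup>2 + 1)"
proof (rule exp_growth_bound[OF \<open>s \<le> t\<close>])
  show "continuous_on {s..t} (\<lambda>x. (v x)\<^sup>2 + 1)" by (intro continuous_intros cont)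
  fix x assume "s < x" "x < t"
  then obtain v' where v': "(v has_real_derivative v') (at x)" "\<bar>v'\<bar> \<le> D * \<bar>v x\<bar> + E"
    using der by blast
  have "2 * \<bar>v x\<bar> \<le> (v x)\<^sup>2 + 1" using zero_le_power2[of "\<bar>v x\<bar> - 1"] by (simp add: power2_eq_square algebra_simps)
  then have E: "E * (2 * \<bar>v x\<bar>) \<le> E * ((v x)\<^sup>2 + 1)" using assms by (intro mult_left_mono)
  show "\<exists>y. ((\<lambda>x. (v x)\<^sup>2 + 1) has_real_derivative y) (at x) \<and> y \<le> (2 * D + E) * ((v x)\<^sup>2 + 1)"
  proof (intro exI conjI)
    show "((\<lambda>x. (v x)\<^sup>2 + 1) has_real_derivative 2 * v x * v') (at x)"
      by (auto intro!: derivative_eq_intros v'(1))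
    have "2 * v x * v' \<le> 2 * \<bar>v x\<bar> * \<bar>v'\<bar>" by (metis abs_ge_self abs_mult abs_numeral)
    also have "\<dots> \<le> 2 * \<bar>v x\<bar> * (D * \<bar>v x\<bar> + E)" using v' by (intro mult_left_mono) auto
    also have "\<dots> = 2 * D * (v x)\<^sup>2 + E * (2 * \<bar>v x\<bar>)"
      by (simp add: power2_eq_square algebra_simps)
    also have "\<dots> \<le> (2 * D + E) * ((v x)\<^sup>2 + 1)" using E assms by (simp add: algebra_simps)
    finally show "2 * v x * v' \<le> (2 * D + E) * ((v x)\<^sup>2 + 1)" .
  qed
qed

text \<open>The right-hand side is truncated to make it bounded, as \<open>peano_shooting\<close> requires; the a priori
  bounds show that solutions never feel the truncation.\<close>

lemma positive_profile_exists:
  fixes G :: "real \<Rightarrow> real \<Rightarrow> real \<Rightarrow> real"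
  assumes G: "continuous_on ({a..b} \<times> UNIV \<times> {0..}) (\<lambda>(r, v, y). G r v y)"
    and Gbd: "\<And>r v y. r \<in> {a..b} \<Longrightarrow> 0 \<le> y \<Longrightarrow> \<bar>G r v y - c * y\<bar> \<le> D * \<bar>v\<bar>"
    and "0 < c" "0 \<le> D" "0 < q" "1 / q < p" "a < b"
  obtains \<mu> u v where "0 < \<mu>" "continuous_on {a..b} u" "continuous_on {a..b} v" "u a = 0" "u b = 0"
    "\<And>x. a < x \<Longrightarrow> x < b \<Longrightarrow> 0 < u x"
    "\<And>x. a < x \<Longrightarrow> x < b \<Longrightarrow> (u has_real_derivative signed_powr q (v x)) (at x)"
    "\<And>x. a < x \<Longrightarrow> x < b \<Longrightarrow> (v has_real_derivative - G x (v x) (\<mu> * u x powr p)) (at x)"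
proof -
  have p: "0 < p" using assms by (meson divide_pos_pos less_trans zero_less_one)
  obtain B where B: "\<And>\<beta> u v. 0 \<le> \<beta> \<Longrightarrow> profile q p D \<beta> a b u v \<Longrightarrow> u a = 0 \<Longrightarrow> v a = 1 \<Longrightarrow>
      0 \<le> u b \<Longrightarrow> \<beta> \<le> B"
    using profile_source_bound[of q p D a b] assms by blast
  \<comment> \<open>\<open>m1\<close> makes \<open>c * m1 = \<bar>B\<bar> + 1\<close> exceed
    \<open>B\<close>. The bounds that follow are not circular: \<open>v \<le> \<kappa>\<close> holds
    however strong the source is, hence \<open>u \<le> U\<close>, hence the source is at most
    \<open>E\<close>, hence \<open>\<bar>v\<bar> \<le> L\<close>. The factor 2 in \<open>L\<close>
    is the value of \<open>v\<^sup>2 + 1\<close> at \<open>a\<close>.\<close>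
  define m1 where "m1 = (\<bar>B\<bar> + 1) / c"
  define \<kappa> where "\<kappa> = exp (D * (b - a))"
  define U where "U = \<kappa> powr q * (b - a)"
  define E where "E = c * m1 * U powr p"
  define L where "L = 2 * exp ((2 * D + E) * (b - a))"
  have m1: "0 < m1" using assms by (simp add: m1_def)
  have \<kappa>: "1 \<le> \<kappa>" using assms by (simp add: \<kappa>_def)
  have U: "0 < U" using assms \<kappa> by (simp add: U_def)
  have E: "0 \<le> E" using assms m1 by (simp add: E_def)
  have L: "0 < L" by (simp add: L_def)
  \<comment> \<open>\<open>G\<close> is controlled only for times in \<open>{a..b}\<close> and
    nonnegative source, so the arguments are clamped into that domain. \<open>src\<close> vanishes
    for negative \<open>u\<close>, so that the source never raises the flux.\<close>
  define ct where "ct t = max a (min b t)" for t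
  define cm where "cm \<mu> = max 0 (min m1 \<mu>)" for \<mu>
  define cv where "cv v = max (- L) (min L v)" for v
  define src where "src \<mu> u = cm \<mu> * (min (max u 0) U) powr p" for \<mu> u
  define f :: "real \<Rightarrow> real \<Rightarrow> real \<times> real \<Rightarrow> real \<times> real"
    where "f \<mu> t x = (signed_powr q (cv (snd x)), - G (ct t) (cv (snd x)) (src \<mu> (fst x)))" for \<mu> t x
  have ct: "ct t \<in> {a..b}" for t using assms by (auto simp: ct_def)
  have cv: "\<bar>cv v\<bar> \<le> L" "\<bar>cv v\<bar> \<le> \<bar>v\<bar>" for v using L by (auto simp: cv_def)
  have src: "0 \<le> src \<mu> u" "src \<mu> u \<le> m1 * U powr p" for \<mu> u
    using U m1 p unfolding src_def cm_def by (auto intro!: mult_mono powr_mono2)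
  have f: "continuous_on UNIV (\<lambda>(\<mu>, t, x). f \<mu> t x)"
  proof -
    have "continuous_on UNIV (\<lambda>z :: real \<times> real \<times> real \<times> real.
        (ct (fst (snd z)), cv (snd (snd (snd z))), src (fst z) (fst (snd (snd z)))))"
      unfolding ct_def cv_def src_def cm_def using U p
      by (intro continuous_intros continuous_on_powr') auto
    moreover have "range (\<lambda>z :: real \<times> real \<times> real \<times> real.
        (ct (fst (snd z)), cv (snd (snd (snd z))), src (fst z) (fst (snd (snd z)))))
        \<subseteq> {a..b} \<times> UNIV \<times> {0..}" using ct src by auto
    ultimately
    have "continuous_on UNIV (\<lambda>z :: real \<times> real \<times> real \<times> real.
        G (ct (fst (snd z))) (cv (snd (snd (snd z)))) (src (fst z) (fst (snd (snd z)))))"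
      using continuous_on_compose2[OF G] by fastforce
    moreover have "continuous_on UNIV (\<lambda>z :: real \<times> real \<times> real \<times> real. cv (snd (snd (snd z))))"
      unfolding cv_def by (intro continuous_intros)
    ultimately show ?thesis unfolding f_def case_prod_beta'
      using \<open>0 < q\<close> by (intro continuous_intros)
  qed
  have bd: "norm (f \<mu> t x) \<le> L powr q + (c * (m1 * U powr p) + D * L)" for \<mu> t x
  proof -
    have "\<bar>signed_powr q (cv (snd x))\<bar> \<le> L powr q"
      unfolding abs_signed_powr using cv assms by (intro powr_mono2) auto
    moreover have "\<bar>G (ct t) (cv (snd x)) (src \<mu> (fst x))\<bar> \<le> c * (m1 * U powr p) + D * L"
    proof -
      have "\<bar>G (ct t) (cv (snd x)) (src \<mu> (fst x)) - c * src \<mu> (fst x)\<bar> \<le> D * \<bar>cv (snd x)\<bar>"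
        using Gbd ct src by blast
      also have "\<dots> \<le> D * L" using cv assms by (intro mult_left_mono) auto
      finally have "\<bar>G (ct t) (cv (snd x)) (src \<mu> (fst x)) - c * src \<mu> (fst x)\<bar> \<le> D * L" .
      moreover have "0 \<le> c * src \<mu> (fst x)" "c * src \<mu> (fst x) \<le> c * (m1 * U powr p)"
        using src assms by (auto intro: mult_left_mono)
      ultimately show ?thesis by linarith
    qed
    ultimately show ?thesis unfolding f_def
      using norm_Pair_le[of "signed_powr q (cv (snd x))" "- G (ct t) (cv (snd x)) (src \<mu> (fst x))"]
      by simp
  qed
  have untruncate: "profile q p D (c * \<mu>) a b (\<lambda>x. fst (y x)) (\<lambda>x. snd (y x)) \<and>
      (\<forall>x. a < x \<longrightarrow> x < b \<longrightarrow> ((\<lambda>x. snd (y x)) has_real_derivative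
        - G x (snd (y x)) (\<mu> * max (fst (y x)) 0 powr p)) (at x))"
    if y: "ode_solution (f \<mu>) a b (0, 1) y" and \<mu>: "\<mu> \<in> {0..m1}" for \<mu> y
  proof -
    define u where "u x = fst (y x)" for x
    define v where "v x = snd (y x)" for x
    have ini: "u a = 0" "v a = 1" using y by (simp_all add: u_def v_def ode_solution_def)
    have cont: "continuous_on {a..b} u" "continuous_on {a..b} v"
      using y unfolding u_def v_def ode_solution_def by (auto intro: continuous_intros)
    have cm: "cm \<mu> = \<mu>" using \<mu> by (auto simp: cm_def)
    have du: "(u has_real_derivative signed_powr q (cv (v x))) (at x)"
      and dv: "(v has_real_derivative - G x (cv (v x)) (src \<mu> (u x))) (at x)" if "a < x" "x < b" for x
      using ode_solution_DERIV[OF y that] that unfolding f_def u_def v_def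
      by (simp_all add: ct_def)
    have Gb: "\<bar>- G x (cv (v x)) (src \<mu> (u x)) + c * src \<mu> (u x)\<bar> \<le> D * \<bar>v x\<bar>"
      if "a < x" "x < b" for x
    proof -
      have "\<bar>G x (cv (v x)) (src \<mu> (u x)) - c * src \<mu> (u x)\<bar> \<le> D * \<bar>cv (v x)\<bar>"
        using Gbd src that by auto
      also have "\<dots> \<le> D * \<bar>v x\<bar>" using cv assms by (intro mult_left_mono) auto
      finally show ?thesis by linarith
    qed
    \<comment> \<open>This holds for the truncated system already: clamping does not increase
      \<open>\<bar>v\<bar>\<close>, and the source is nonnegative.\<close>
    have "growth_le D a b v" unfolding growth_le_def
    proof (intro conjI allI impI cont)
      fix x assume x: "a < x" "x < b"
      have "0 \<le> c * src \<mu> (u x)" using src assms by simp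
      then have "- G x (cv (v x)) (src \<mu> (u x)) \<le> D * \<bar>v x\<bar>" using Gb[OF x] by linarith
      then show "\<exists>v'. (v has_real_derivative v') (at x) \<and> v' \<le> D * \<bar>v x\<bar>"
        using dv[OF x] by blast
    qed
    have vk: "v x \<le> \<kappa>" if "x \<in> {a..b}" for x
    proof (cases "0 \<le> v x")
      case True
      then have "v x \<le> exp (D * (x - a)) * v a"
        using growth_le_growth[OF growth_le_subinterval[OF \<open>growth_le D a b v\<close>, of a x]] that by auto
      also have "\<dots> \<le> \<kappa>" using that assms by (auto simp: ini \<kappa>_def intro!: mult_left_mono)
      finally show ?thesis .
    qed (use \<kappa> in linarith)
    have uU: "u x \<le> U" if "x \<in> {a..b}" for x
    proof (cases "x = a")
      case False
      then have ax: "a < x" using that by auto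
      have "continuous_on {a..x} u" using cont that by (auto elim: continuous_on_subset)
      moreover have "u differentiable (at z)" if "a < z" "z < x" for z
        using du[of z] that \<open>x \<in> {a..b}\<close> by (auto simp: real_differentiable_def)
      ultimately obtain d z where z: "a < z" "z < x" "(u has_real_derivative d) (at z)"
        "u x - u a = (x - a) * d" using MVT[OF ax] by blast
      have zb: "z < b" using z that by auto
      have d: "d = signed_powr q (cv (v z))" using DERIV_unique[OF z(3) du] z zb by blast
      have "signed_powr q (cv (v z)) \<le> \<kappa> powr q"
      proof (cases "0 \<le> cv (v z)")
        case True
        have "cv (v z) \<le> \<kappa>" using vk[of z] z zb L \<kappa> by (auto simp: cv_def)
        then show ?thesis using True assms by (simp add: signed_powr_nonneg powr_mono2)
      next
        case False
        then have "signed_powr q (cv (v z)) \<le> 0" by (simp add: signed_powr_nonpos)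
        then show ?thesis using powr_ge_zero[of \<kappa> q] by linarith
      qed
      then have "(x - a) * d \<le> (x - a) * \<kappa> powr q" using ax d by (intro mult_left_mono) auto
      also have "\<dots> \<le> (b - a) * \<kappa> powr q" using that by (intro mult_right_mono) auto
      finally have "(x - a) * d \<le> (b - a) * \<kappa> powr q" .
      then show ?thesis using z ini by (simp add: U_def mult.commute)
    qed (use U ini in simp)
    have vL: "cv (v x) = v x" if "x \<in> {a..b}" for x
    proof -
      have "(v x)\<^sup>2 + 1 \<le> exp ((2 * D + E) * (x - a)) * ((v a)\<^sup>2 + 1)"
      proof (rule quadratic_growth_bound)
        show "continuous_on {a..x} v" using cont that by (auto elim: continuous_on_subset)
        fix z assume z: "a < z" "z < x"
        then have zb: "z < b" using that by auto
        have "c * src \<mu> (u z) \<le> E" "0 \<le> c * src \<mu> (u z)"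
          using src assms by (auto simp: E_def mult.assoc intro!: mult_left_mono)
        then have "\<bar>- G z (cv (v z)) (src \<mu> (u z))\<bar> \<le> D * \<bar>v z\<bar> + E"
          using Gb[OF z(1) zb] by linarith
        then show "\<exists>v'. (v has_real_derivative v') (at z) \<and> \<bar>v'\<bar> \<le> D * \<bar>v z\<bar> + E"
          using dv[OF z(1) zb] by blast
      qed (use that E assms in auto)
      also have "\<dots> \<le> exp ((2 * D + E) * (b - a)) * ((v a)\<^sup>2 + 1)"
        using that E assms by (intro mult_right_mono) (auto intro!: mult_left_mono)
      finally have *: "(v x)\<^sup>2 + 1 \<le> L" by (simp add: L_def ini)
      have "2 * \<bar>v x\<bar> \<le> (v x)\<^sup>2 + 1"
        using zero_le_power2[of "\<bar>v x\<bar> - 1"] by (simp add: power2_eq_square algebra_simps)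
      then have "\<bar>v x\<bar> \<le> L" using * by linarith
      then show ?thesis by (auto simp: cv_def)
    qed
    have srcu: "src \<mu> (u x) = \<mu> * max (u x) 0 powr p" if "x \<in> {a..b}" for x
      using uU[OF that] U by (simp add: src_def cm min_def)
    have "profile q p D (c * \<mu>) a b u v"
      unfolding profile_def
    proof (intro conjI allI impI cont)
      fix x assume x: "a < x" "x < b"
      show "(u has_real_derivative signed_powr q (v x)) (at x)" using du[OF x] vL x by simp
      show "\<exists>v'. (v has_real_derivative v') (at x) \<and> \<bar>v' + c * \<mu> * max (u x) 0 powr p\<bar> \<le> D * \<bar>v x\<bar>"
        using dv[OF x] Gb[OF x] srcu[of x] x by (auto simp: mult.assoc)
    qed
    moreover have "(v has_real_derivative - G x (v x) (\<mu> * max (u x) 0 powr p)) (at x)"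
      if "a < x" "x < b" for x
      using dv[OF that] srcu[of x] vL[of x] that by simp
    ultimately show ?thesis unfolding u_def v_def by blast
  qed
  have "\<exists>\<mu>\<in>{0..m1}. \<exists>y. ode_solution (f \<mu>) a b (0, 1) y \<and> fst (y b) = 0"
  proof (rule peano_shooting[OF f bd])
    show "0 < fst (y b)" if "ode_solution (f 0) a b (0, 1) y" for y
      using untruncate[OF that] profile_no_source_pos[of q p D a b "\<lambda>x. fst (y x)" "\<lambda>x. snd (y x)"]
        that m1 assms by (auto simp: ode_solution_def)
    show "fst (y b) < 0" if "ode_solution (f m1) a b (0, 1) y" for y
    proof (rule ccontr)
      assume "\<not> fst (y b) < 0"
      then have "c * m1 \<le> B"
        using untruncate[OF that] that m1 assms B[of "c * m1" "\<lambda>x. fst (y x)" "\<lambda>x. snd (y x)"]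
        by (auto simp: ode_solution_def)
      then show False using assms by (simp add: m1_def)
    qed
  qed (use m1 assms in \<open>auto intro: continuous_intros\<close>)
  then obtain \<mu> y where \<mu>: "\<mu> \<in> {0..m1}" and y: "ode_solution (f \<mu>) a b (0, 1) y" and yb: "fst (y b) = 0"
    by blast
  define u where "u x = fst (y x)" for x
  define v where "v x = snd (y x)" for x
  have ini: "u a = 0" "v a = 1" "u b = 0" using y yb by (simp_all add: u_def v_def ode_solution_def)
  have P: "profile q p D (c * \<mu>) a b u v"
    and dv: "\<And>x. a < x \<Longrightarrow> x < b \<Longrightarrow> (v has_real_derivative - G x (v x) (\<mu> * max (u x) 0 powr p)) (at x)"
    using untruncate[OF y \<mu>] unfolding u_def v_def by auto
  have pos: "0 < u x" if "a < x" "x < b" for x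
    using profile_pos[OF P] that \<mu> ini assms by auto
  have "\<mu> \<noteq> 0"
    using profile_no_source_pos[of q p D a b u v] P ini assms by auto
  then have "0 < \<mu>" using \<mu> by auto
  moreover have "(v has_real_derivative - G x (v x) (\<mu> * u x powr p)) (at x)" if "a < x" "x < b" for x
    using dv[OF that] pos[OF that] by (simp add: max_absorb1)
  ultimately show ?thesis
    using that[of \<mu> u v] P ini pos unfolding profile_def by blast
qed

section \<open>Radial functions and test functions\<close>

lemma C2_with_DERIV_line:
  assumes "C2_with S \<phi> g H" "x + t *\<^sub>R h \<in> S"
  shows "((\<lambda>t. \<phi> (x + t *\<^sub>R h)) has_real_derivative g (x + t *\<^sub>R h) \<bullet> h) (at t)"
    and "((\<lambda>t. g (x + t *\<^sub>R h) \<bullet> k) has_real_derivative (H (x + t *\<^sub>R h) *v h) \<bullet> k) (at t)"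
proof -
  have l: "((\<lambda>t. x + t *\<^sub>R h) has_derivative (\<lambda>s. s *\<^sub>R h)) (at t)"
    by (auto intro!: derivative_eq_intros)
  have "GDERIV \<phi> (x + t *\<^sub>R h) :> g (x + t *\<^sub>R h)" using assms by (simp add: C2_with_def)
  then have "(\<phi> has_derivative (\<lambda>y. y \<bullet> g (x + t *\<^sub>R h))) (at (x + t *\<^sub>R h))"
    by (simp add: gderiv_def)
  from has_derivative_compose[OF l this]
  show "((\<lambda>t. \<phi> (x + t *\<^sub>R h)) has_real_derivative g (x + t *\<^sub>R h) \<bullet> h) (at t)"
    by (simp add: has_field_derivative_def inner_commute mult_commute_abs)
  have "(g has_derivative (\<lambda>y. H (x + t *\<^sub>R h) *v y)) (at (x + t *\<^sub>R h))"
    using assms by (simp add: C2_with_def)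
  from has_derivative_inner_left[OF has_derivative_compose[OF l this], of k]
  show "((\<lambda>t. g (x + t *\<^sub>R h) \<bullet> k) has_real_derivative (H (x + t *\<^sub>R h) *v h) \<bullet> k) (at t)"
    by (simp add: has_field_derivative_def matrix_vector_mult_scaleR mult_commute_abs)
qed

text \<open>The second difference of \<open>\<phi>\<close> in the directions \<open>h\<close> and \<open>k\<close> is asymptotic to \<open>s\<^sup>2 (H x k) \<bullet> h\<close>, and
  it is symmetric in \<open>h\<close> and \<open>k\<close>.\<close>

lemma C2_with_second_difference:
  assumes C2: "C2_with S \<phi> g H" and "open S" "x \<in> S" "0 < e"
  shows "\<exists>d>0. \<forall>s. 0 < s \<and> s < d \<longrightarrow>
    \<bar>\<phi> (x + s *\<^sub>R h + s *\<^sub>R k) - \<phi> (x + s *\<^sub>R h) - \<phi> (x + s *\<^sub>R k) + \<phi> x - s\<^sup>2 * ((H x *v k) \<bullet> h)\<bar> \<le> e * s\<^sup>2"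
proof -
  define N where "N = norm h + norm k + 1"
  have N: "0 < N" "norm h \<le> N" by (simp_all add: N_def add_nonneg_pos)
  \<comment> \<open>Two gradient remainders of size at most \<open>e' * (s * N)\<close>, each paired
    with \<open>h\<close> of norm at most \<open>N\<close> and multiplied by \<open>s\<close>, add
    up to \<open>e * s\<^sup>2\<close>.\<close>
  define e' where "e' = e / (2 * N\<^sup>2)"
  have e': "0 < e'" using N assms by (simp add: e'_def)
  have "(g has_derivative (\<lambda>h. H x *v h)) (at x)" using C2 \<open>x \<in> S\<close> by (simp add: C2_with_def)
  then obtain d1 where d1: "0 < d1"
    "\<And>y. norm (y - x) < d1 \<Longrightarrow> norm (g y - g x - H x *v (y - x)) \<le> e' * norm (y - x)"
    using e' unfolding has_derivative_at_alt by blast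
  obtain d2 where d2: "0 < d2" "ball x d2 \<subseteq> S" using assms open_contains_ball by blast
  define d where "d = min d1 d2 / N"
  have d: "0 < d" using d1 d2 N by (simp add: d_def)
  show ?thesis
  proof (intro exI[of _ d] conjI allI impI d)
    fix s assume s: "0 < s \<and> s < d"
    then have sN: "s * N < d1" "s * N < d2" using N by (simp_all add: d_def field_simps)
    have near: "norm (t *\<^sub>R h + \<theta> *\<^sub>R k) \<le> s * N" if "0 \<le> t" "t \<le> s" "0 \<le> \<theta>" "\<theta> \<le> s" for t \<theta>
    proof -
      have "norm (t *\<^sub>R h + \<theta> *\<^sub>R k) \<le> t * norm h + \<theta> * norm k"
        using norm_triangle_ineq[of "t *\<^sub>R h" "\<theta> *\<^sub>R k"] that by simp
      also have "\<dots> \<le> s * norm h + s * norm k" using that by (intro add_mono mult_right_mono) auto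
      also have "\<dots> \<le> s * N" using s by (simp add: N_def algebra_simps)
      finally show ?thesis .
    qed
    have inS: "x + \<theta> *\<^sub>R k + t *\<^sub>R h \<in> S" if "0 \<le> t" "t \<le> s" "0 \<le> \<theta>" "\<theta> \<le> s" for t \<theta>
    proof -
      have "dist x (x + \<theta> *\<^sub>R k + t *\<^sub>R h) = norm (t *\<^sub>R h + \<theta> *\<^sub>R k)"
        by (simp add: dist_norm norm_minus_commute add.commute flip: minus_add_distrib)
      then show ?thesis using near[OF that] sN d2 by (auto simp: subset_iff)
    qed
    \<comment> \<open>The increment in direction \<open>k\<close>, as a function of the displacement
      in direction \<open>h\<close>. The mean value theorem turns the second difference into a
      difference of gradients at two points, each expanded about \<open>x\<close>.\<close>
    define f where "f t = \<phi> (x + s *\<^sub>R k + t *\<^sub>R h) - \<phi> (x + t *\<^sub>R h)" for t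
    have df: "(f has_real_derivative (g (x + s *\<^sub>R k + t *\<^sub>R h) \<bullet> h - g (x + t *\<^sub>R h) \<bullet> h)) (at t)"
      if "0 \<le> t" "t \<le> s" for t
      unfolding f_def using inS[of t s] inS[of t 0] that s
      by (intro DERIV_diff C2_with_DERIV_line(1)[OF C2]) auto
    obtain z where z: "0 < z" "z < s"
      "f s - f 0 = (s - 0) * (g (x + s *\<^sub>R k + z *\<^sub>R h) \<bullet> h - g (x + z *\<^sub>R h) \<bullet> h)"
      using MVT2[of 0 s f, OF _ df] s by auto
    define R where "R y = g y - g x - H x *v (y - x)" for y
    have R: "norm (R (x + \<theta> *\<^sub>R k + z *\<^sub>R h)) \<le> e' * (s * N)" if "0 \<le> \<theta>" "\<theta> \<le> s" for \<theta>
    proof -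
      have *: "x + \<theta> *\<^sub>R k + z *\<^sub>R h - x = z *\<^sub>R h + \<theta> *\<^sub>R k" by simp
      have n: "norm (z *\<^sub>R h + \<theta> *\<^sub>R k) \<le> s * N" using near z that by simp
      then have "norm (R (x + \<theta> *\<^sub>R k + z *\<^sub>R h)) \<le> e' * norm (z *\<^sub>R h + \<theta> *\<^sub>R k)"
        using d1(2)[of "x + \<theta> *\<^sub>R k + z *\<^sub>R h"] sN unfolding R_def * by simp
      also have "\<dots> \<le> e' * (s * N)" using n e' by (intro mult_left_mono) auto
      finally show ?thesis .
    qed
    define y0 where "y0 = x + 0 *\<^sub>R k + z *\<^sub>R h"
    define y1 where "y1 = x + s *\<^sub>R k + z *\<^sub>R h"
    have "y1 - y0 = s *\<^sub>R k" by (simp add: y0_def y1_def)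
    then have "H x *v (y1 - x) - H x *v (y0 - x) = s *\<^sub>R (H x *v k)"
      by (simp add: matrix_vector_mult_scaleR flip: matrix_vector_mult_diff_distrib)
    then have gy: "g y1 - g y0 = R y1 - R y0 + s *\<^sub>R (H x *v k)"
      unfolding R_def by (simp add: algebra_simps)
    have "f s - f 0 = s * ((g y1 - g y0) \<bullet> h)"
      using z by (simp add: y0_def y1_def inner_diff_left)
    then have "f s - f 0 - s\<^sup>2 * ((H x *v k) \<bullet> h) = s * ((R y1 - R y0) \<bullet> h)"
      unfolding gy by (simp add: inner_add_left power2_eq_square algebra_simps)
    also have "\<bar>\<dots>\<bar> \<le> s * ((e' * (s * N) + e' * (s * N)) * N)"
    proof -
      have "\<bar>(R y1 - R y0) \<bullet> h\<bar> \<le> norm (R y1 - R y0) * norm h"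
        by (rule Cauchy_Schwarz_ineq2)
      also have "\<dots> \<le> (e' * (s * N) + e' * (s * N)) * N"
        using s N e' unfolding y0_def y1_def
        by (intro mult_mono order_trans[OF norm_triangle_ineq4] add_mono R) auto
      finally show ?thesis using s by (simp add: abs_mult)
    qed
    also have "\<dots> = e * s\<^sup>2" using N by (simp add: e'_def power2_eq_square)
    finally show "\<bar>\<phi> (x + s *\<^sub>R h + s *\<^sub>R k) - \<phi> (x + s *\<^sub>R h) - \<phi> (x + s *\<^sub>R k) + \<phi> x
        - s\<^sup>2 * ((H x *v k) \<bullet> h)\<bar> \<le> e * s\<^sup>2"
      by (simp add: f_def algebra_simps)
  qed
qed

text \<open>The second difference is symmetric in \<open>h\<close> and \<open>k\<close>, so both
  asymptotic values agree. Ellipticity speaks of symmetric matrices only, so this is what allows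
  test Hessians to be compared.\<close>

lemma C2_with_symmetric:
  fixes \<phi> :: "real^'n \<Rightarrow> real"
  assumes C2: "C2_with S \<phi> g H" and S: "open S" "x \<in> S"
  shows "symmetric_matrix (H x)"
proof -
  have sym: "(H x *v k) \<bullet> h = (H x *v h) \<bullet> k" for h k
  proof (rule ccontr)
    assume ne: "(H x *v k) \<bullet> h \<noteq> (H x *v h) \<bullet> k"
    define e where "e = \<bar>(H x *v k) \<bullet> h - (H x *v h) \<bullet> k\<bar> / 4"
    have e: "0 < e" using ne by (simp add: e_def)
    obtain d1 where d1: "d1 > 0" "\<And>s. 0 < s \<and> s < d1 \<Longrightarrow>
      \<bar>\<phi> (x + s *\<^sub>R h + s *\<^sub>R k) - \<phi> (x + s *\<^sub>R h) - \<phi> (x + s *\<^sub>R k) + \<phi> x - s\<^sup>2 * ((H x *v k) \<bullet> h)\<bar> \<le> e * s\<^sup>2"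
      using C2_with_second_difference[OF C2 S e, of h k] by blast
    obtain d2 where d2: "d2 > 0" "\<And>s. 0 < s \<and> s < d2 \<Longrightarrow>
      \<bar>\<phi> (x + s *\<^sub>R k + s *\<^sub>R h) - \<phi> (x + s *\<^sub>R k) - \<phi> (x + s *\<^sub>R h) + \<phi> x - s\<^sup>2 * ((H x *v h) \<bullet> k)\<bar> \<le> e * s\<^sup>2"
      using C2_with_second_difference[OF C2 S e, of k h] by blast
    define s where "s = min d1 d2 / 2"
    have s: "0 < s" "s < d1" "s < d2" using d1 d2 by (auto simp: s_def)
    have c: "x + s *\<^sub>R k + s *\<^sub>R h = x + s *\<^sub>R h + s *\<^sub>R k" by simp
    have "\<bar>s\<^sup>2 * ((H x *v k) \<bullet> h) - s\<^sup>2 * ((H x *v h) \<bullet> k)\<bar> \<le> 2 * (e * s\<^sup>2)"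
      using d1(2)[of s] d2(2)[of s] s unfolding c by linarith
    then have "s\<^sup>2 * (4 * e) \<le> s\<^sup>2 * (2 * e)"
      by (simp add: e_def abs_mult mult.commute flip: right_diff_distrib)
    then show False using s e by simp
  qed
  have "H x $ i $ j = H x $ j $ i" for i j
    using sym[of "axis j 1" "axis i 1"]
    by (simp add: inner_axis matrix_vector_mul_component)
  then show ?thesis by (simp add: symmetric_matrix_def transpose_def vec_eq_iff)
qed

text \<open>The Hessian of a radial function in the direction \<open>e\<close>, with radial eigenvalue \<open>m\<close> and tangential
  eigenvalue \<open>l\<close>.\<close>

definition radial_hessian :: "real^'n \<Rightarrow> real \<Rightarrow> real \<Rightarrow> real^'n^'n" where
  "radial_hessian e m l = (\<chi> i j. l * (if i = j then 1 else 0) + (m - l) * (e $ i * e $ j))"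

lemma radial_hessian_mult: "radial_hessian e m l *v h = l *\<^sub>R h + ((m - l) * (e \<bullet> h)) *\<^sub>R e"
proof -
  have "(\<Sum>j\<in>UNIV. (l * (if i = j then 1 else 0) + (m - l) * (e $ i * e $ j)) * h $ j)
    = l * h $ i + (m - l) * (e \<bullet> h) * e $ i" for i
  proof -
    have "(\<Sum>j\<in>UNIV. (l * (if i = j then 1 else 0) + (m - l) * (e $ i * e $ j)) * h $ j)
      = (\<Sum>j\<in>UNIV. (if i = j then l * h $ j else 0) + (m - l) * e $ i * (e $ j * h $ j))"
      by (intro sum.cong) (auto simp: algebra_simps)
    then show ?thesis by (simp add: sum.distrib inner_vec_def flip: sum_distrib_left)
  qed
  then show ?thesis by (simp add: vec_eq_iff matrix_vector_mult_def radial_hessian_def)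
qed

lemma symmetric_radial_hessian: "symmetric_matrix (radial_hessian e m l)"
  by (auto simp: symmetric_matrix_def transpose_def vec_eq_iff radial_hessian_def mult.commute)

lemma minus_radial_hessian: "- radial_hessian e m l = radial_hessian e (- m) (- l)"
  by (simp add: vec_eq_iff radial_hessian_def algebra_simps)

text \<open>Turns the hypothesis on radial functions into an algebraic one on matrices. The
  quadratic \<open>w\<close> is chosen so that its first and second derivatives at 1 are
  \<open>l\<close> and \<open>m\<close>; at the unit vector \<open>e\<close> its Hessian is the
  prescribed one.\<close>

lemma radial_formula_hessian:
  fixes F :: "real^'n^'n \<Rightarrow> real"
  assumes F: "radial_formula F kp km Kp Km" and e: "norm e = 1"
  shows "F (radial_hessian e m l) = (real CARD('n) - 1) * (kp * pos_part l - km * neg_part l)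
    + Kp * pos_part m - Km * neg_part m"
proof -
  define w where "w r = (l - m) * r + m / 2 * r\<^sup>2" for r :: real
  define w1 where "w1 r = (l - m) + m * r" for r :: real
  define g where "g x = ((l - m) / norm x + m) *\<^sub>R x" for x :: "real^'n"
  define H where "H x = radial_hessian (sgn x) m ((l - m) / norm x + m)" for x :: "real^'n"
  have w: "(w has_real_derivative w1 r) (at r)" for r
    unfolding w_def w1_def by (auto intro!: derivative_eq_intros)
  have w1: "(w1 has_real_derivative m) (at r)" for r
    unfolding w1_def by (auto intro!: derivative_eq_intros)
  have C2: "C2_with (- {0}) (\<lambda>x :: real^'n. w (norm x)) g H"
    unfolding C2_with_def
  proof (intro conjI ballI)
    fix x :: "real^'n" assume "x \<in> - {0}"
    then have x: "x \<noteq> 0" by simp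
    have "w1 (norm x) *\<^sub>R sgn x = g x"
      using x by (simp add: w1_def g_def sgn_div_norm field_simps)
    then show "GDERIV (\<lambda>x. w (norm x)) x :> g x"
      using GDERIV_DERIV_compose[OF GDERIV_norm[OF x] w] by simp
    have "((\<lambda>x. norm x) has_derivative (\<lambda>h. h \<bullet> sgn x)) (at x)"
      using GDERIV_norm[OF x] by (simp add: gderiv_def)
    then have "((\<lambda>x. (l - m) / norm x + m) has_derivative
        (\<lambda>h. - (l - m) * (h \<bullet> sgn x) / (norm x)\<^sup>2)) (at x)"
      using x by (auto intro!: derivative_eq_intros simp: power2_eq_square field_simps)
    from has_derivative_scaleR[OF this has_derivative_ident]
    have "(g has_derivative (\<lambda>h. ((l - m) / norm x + m) *\<^sub>R h
        + (- (l - m) * (h \<bullet> sgn x) / (norm x)\<^sup>2) *\<^sub>R x)) (at x)"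
      unfolding g_def .
    moreover have "(- (l - m) * (h \<bullet> sgn x) / (norm x)\<^sup>2) *\<^sub>R x
        = ((m - ((l - m) / norm x + m)) * (sgn x \<bullet> h)) *\<^sub>R sgn x" for h
      using x by (simp add: sgn_div_norm power2_eq_square inner_commute field_simps)
    ultimately show "(g has_derivative (\<lambda>h. H x *v h)) (at x)"
      unfolding H_def radial_hessian_mult by simp
  next
    show "continuous_on (- {0}) H"
      unfolding H_def radial_hessian_def sgn_div_norm
      by (intro continuous_on_vec_lambda continuous_intros) auto
  qed
  have "e \<noteq> 0" using e by auto
  with F[unfolded radial_formula_def, THEN spec[of _ w], THEN spec[of _ w1], THEN spec[of _ "\<lambda>_. m"],
      THEN spec[of _ g], THEN spec[of _ H]] w w1 C2
  have "F (H e) = (real CARD('n) - 1) / norm e *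
      (kp * pos_part (w1 (norm e)) - km * neg_part (w1 (norm e))) + Kp * pos_part m - Km * neg_part m"
    by (simp add: Let_def)
  then show ?thesis using e by (simp add: H_def w1_def sgn_div_norm)
qed

text \<open>Ellipticity is applied to the increment \<open>B - A\<close>, whose trace is nonnegative
  because its diagonal entries are values of the quadratic form at basis vectors.\<close>

lemma uniformly_elliptic_mono:
  assumes F: "uniformly_elliptic lam Lam F" "0 < lam"
    and A: "symmetric_matrix A" and B: "symmetric_matrix B" and le: "\<And>h. h \<bullet> (A *v h) \<le> h \<bullet> (B *v h)"
  shows "F A \<le> F B"
proof -
  have nn: "nonneg_matrix (B - A)"
    using A B le unfolding nonneg_matrix_def symmetric_matrix_def
    by (auto simp: matrix_vector_mult_diff_rdistrib inner_diff_right transpose_def vec_eq_iff)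
  have "0 \<le> (B - A) $ i $ i" for i
  proof -
    have "0 \<le> axis i 1 \<bullet> ((B - A) *v axis i 1)" using nn by (simp add: nonneg_matrix_def)
    then show ?thesis by (simp add: inner_axis' matrix_vector_mul_component inner_axis)
  qed
  then have "0 \<le> trace (B - A)" unfolding trace_def by (intro sum_nonneg) auto
  then have "0 \<le> lam * trace (B - A)" using F by simp
  also have "\<dots> \<le> F (A + (B - A)) - F A" using F nn A unfolding uniformly_elliptic_def by blast
  finally show ?thesis by simp
qed

lemma local_max_second_derivative:
  fixes \<psi> \<psi>1 :: "real \<Rightarrow> real"
  assumes "0 < d" and der: "\<And>t. \<bar>t\<bar> < d \<Longrightarrow> (\<psi> has_real_derivative \<psi>1 t) (at t)"
    and der2: "(\<psi>1 has_real_derivative m) (at 0)"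
    and max: "\<And>t. \<bar>t\<bar> < d \<Longrightarrow> \<psi> t \<le> \<psi> 0"
  shows "m \<le> 0"
proof -
  have 0: "\<psi>1 0 = 0"
    using DERIV_local_max[OF der, of 0 d] max \<open>0 < d\<close> by simp
  show ?thesis
  proof (rule ccontr)
    assume "\<not> m \<le> 0"
    then obtain e where e: "0 < e" "\<And>h. 0 < h \<Longrightarrow> h < e \<Longrightarrow> \<psi>1 0 < \<psi>1 (0 + h)"
      using DERIV_pos_inc_right[OF der2] by auto
    define t where "t = min d e / 2"
    have t: "0 < t" "t < d" "t < e" using \<open>0 < d\<close> e by (auto simp: t_def)
    then obtain z where z: "0 < z" "z < t" "\<psi> t - \<psi> 0 = (t - 0) * \<psi>1 z"
      using MVT2[of 0 t \<psi> \<psi>1] der by auto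
    have "0 < \<psi>1 z" using e(2)[of z] z t 0 by simp
    then have "0 < t * \<psi>1 z" using t by simp
    then show False using z max[of t] t by auto
  qed
qed

lemma DERIV_norm_line:
  fixes x h :: "'a::real_inner"
  assumes "x + t *\<^sub>R h \<noteq> 0"
  shows "((\<lambda>t. norm (x + t *\<^sub>R h)) has_real_derivative (sgn (x + t *\<^sub>R h) \<bullet> h)) (at t)"
proof -
  have l: "((\<lambda>t. x + t *\<^sub>R h) has_derivative (\<lambda>s. s *\<^sub>R h)) (at t)"
    by (auto intro!: derivative_eq_intros)
  have "(norm has_derivative (\<lambda>y. y \<bullet> sgn (x + t *\<^sub>R h))) (at (x + t *\<^sub>R h))"
    using GDERIV_norm[OF assms] by (simp add: gderiv_def)
  from has_derivative_compose[OF l this] show ?thesis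
    by (simp add: has_field_derivative_def inner_commute mult_commute_abs)
qed

text \<open>The difference is differentiable at its local maximum, so its gradient vanishes. Hence a
  test function with nonzero gradient can touch only where u' is nonzero, which is where u'' is
  available.\<close>

lemma radial_touching_gradient:
  fixes \<phi> :: "real^'n \<Rightarrow> real"
  assumes C2: "C2_with \<Omega> \<phi> g H" and \<Omega>: "open \<Omega>" "x0 \<in> \<Omega>" "x0 \<noteq> 0"
    and u: "(u has_real_derivative c) (at (norm x0))"
    and touch: "\<forall>\<^sub>F x in at x0 within \<Omega>. u (norm x) - \<phi> x \<le> u (norm x0) - \<phi> x0"
  shows "g x0 = c *\<^sub>R sgn x0"
proof -
  have "\<forall>\<^sub>F x in at x0. u (norm x) - \<phi> x \<le> u (norm x0) - \<phi> x0"
    using touch at_within_open[OF \<Omega>(2,1)] by simp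
  then obtain d where d: "0 < d" "\<And>x. dist x x0 < d \<Longrightarrow> u (norm x) - \<phi> x \<le> u (norm x0) - \<phi> x0"
    unfolding eventually_at by (metis UNIV_I order_refl)
  have "GDERIV \<phi> x0 :> g x0" using C2 \<Omega> by (simp add: C2_with_def)
  from GDERIV_diff[OF GDERIV_DERIV_compose[OF GDERIV_norm[OF \<Omega>(3)] u] this]
  have "((\<lambda>x. u (norm x) - \<phi> x) has_derivative (\<lambda>h. h \<bullet> (c *\<^sub>R sgn x0 - g x0))) (at x0)"
    by (simp add: gderiv_def)
  from differential_zero_maxmin[OF centre_in_ball[THEN iffD2, OF d(1)] open_ball this] d(2)
  have "(\<lambda>h. h \<bullet> (c *\<^sub>R sgn x0 - g x0)) = (\<lambda>h. 0)" by (auto simp: dist_commute)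
  then have "(c *\<^sub>R sgn x0 - g x0) \<bullet> (c *\<^sub>R sgn x0 - g x0) = 0" by metis
  then show ?thesis by simp
qed

text \<open>The second derivative of u is given at the single radius \<open>norm x0\<close>, so the
  second derivative test is carried out along each line through \<open>x0\<close>, where it asks for
  differentiability of the first derivative at one point.\<close>

lemma radial_touching_above:
  fixes \<phi> :: "real^'n \<Rightarrow> real"
  assumes C2: "C2_with \<Omega> \<phi> g H" and \<Omega>: "open \<Omega>" "x0 \<in> \<Omega>" "x0 \<noteq> 0"
    and d: "0 < d" and u: "\<And>r. \<bar>r - norm x0\<bar> < d \<Longrightarrow> (u has_real_derivative u1 r) (at r)"
    and u1: "(u1 has_real_derivative m) (at (norm x0))"
    and touch: "\<forall>\<^sub>F x in at x0 within \<Omega>. u (norm x) - \<phi> x \<le> u (norm x0) - \<phi> x0"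
  shows "h \<bullet> (radial_hessian (sgn x0) m (u1 (norm x0) / norm x0) *v h) \<le> h \<bullet> (H x0 *v h)"
proof -
  have "\<forall>\<^sub>F x in at x0. u (norm x) - \<phi> x \<le> u (norm x0) - \<phi> x0"
    using touch at_within_open[OF \<Omega>(2,1)] by simp
  then obtain d1 where d1: "0 < d1" "\<And>x. dist x x0 < d1 \<Longrightarrow> u (norm x) - \<phi> x \<le> u (norm x0) - \<phi> x0"
    unfolding eventually_at by (metis UNIV_I order_refl)
  obtain d2 where d2: "0 < d2" "ball x0 d2 \<subseteq> \<Omega>" using \<Omega> open_contains_ball by blast
  \<comment> \<open>Within this radius the line avoids the origin, stays in \<open>\<Omega>\<close>
    and in the touching neighbourhood, and its norms stay where \<open>u\<close> is
    differentiable.\<close>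
  define d3 where "d3 = min (min d (norm x0)) (min d1 d2)"
  have d3: "0 < d3" using d d1 d2 \<Omega> by (simp add: d3_def)
  define e where "e = d3 / (norm h + 1)"
  have e: "0 < e" using d3 by (simp add: e_def add_nonneg_pos)
  define X where "X t = x0 + t *\<^sub>R h" for t
  have X: "norm (X t - x0) < d3" if "\<bar>t\<bar> < e" for t
  proof -
    have "\<bar>t\<bar> * norm h \<le> \<bar>t\<bar> * (norm h + 1)" by (simp add: mult_left_mono)
    also have "\<dots> < d3" using that pos_less_divide_eq[of "norm h + 1" "\<bar>t\<bar>" d3] by (simp add: e_def add_nonneg_pos)
    finally show ?thesis by (simp add: X_def)
  qed
  have X0: "X t \<noteq> 0" if "\<bar>t\<bar> < e" for t
    using X[OF that] by (auto simp: d3_def)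
  have XO: "X t \<in> \<Omega>" if "\<bar>t\<bar> < e" for t
    using X[OF that] d2 by (auto simp: d3_def dist_norm norm_minus_commute subset_iff)
  have Xd: "\<bar>norm (X t) - norm x0\<bar> < d" if "\<bar>t\<bar> < e" for t
    using X[OF that] norm_triangle_ineq3[of "X t" x0] by (simp add: d3_def)
  have N: "((\<lambda>t. norm (X t)) has_real_derivative (sgn (X t) \<bullet> h)) (at t)" if "\<bar>t\<bar> < e" for t
    using DERIV_norm_line X0[OF that] unfolding X_def by blast
  define \<psi> where "\<psi> t = u (norm (X t)) - \<phi> (X t)" for t
  define \<psi>1 where "\<psi>1 t = u1 (norm (X t)) * (sgn (X t) \<bullet> h) - g (X t) \<bullet> h" for t
  have d\<psi>: "(\<psi> has_real_derivative \<psi>1 t) (at t)" if "\<bar>t\<bar> < e" for t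
    unfolding \<psi>_def \<psi>1_def
    using DERIV_diff[OF DERIV_chain2[OF u[OF Xd[OF that]] N[OF that]]
        C2_with_DERIV_line(1)[OF C2, of x0 t h]] XO[OF that]
    by (simp add: X_def)
  let ?r = "norm x0"
  let ?l = "u1 ?r / ?r"
  have X00: "X 0 = x0" by (simp add: X_def)
  \<comment> \<open>The derivative of the direction \<open>sgn (X t) \<bullet> h\<close>. Multiplied
    by \<open>u1 ?r\<close>, it produces the tangential eigenvalue \<open>?l\<close>.\<close>
  have s: "((\<lambda>t. (X t \<bullet> h) / norm (X t)) has_real_derivative
      ((h \<bullet> h) * ?r - (x0 \<bullet> h) * (sgn x0 \<bullet> h)) / (?r * ?r)) (at 0)"
  proof -
    have "((\<lambda>t. X t \<bullet> h) has_real_derivative h \<bullet> h) (at 0)"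
      unfolding X_def inner_add_left by (auto intro!: derivative_eq_intros)
    from DERIV_divide[OF this N[of 0]] show ?thesis using e \<Omega> by (simp add: X00)
  qed
  have sg: "sgn y \<bullet> h = (y \<bullet> h) / norm y" for y :: "real^'n"
    by (simp add: sgn_div_norm divide_inverse mult.commute)
  have du1: "((\<lambda>t. u1 (norm (X t))) has_real_derivative m * (sgn x0 \<bullet> h)) (at 0)"
    using DERIV_chain2[of u1 m "\<lambda>t. norm (X t)" 0] u1 N[of 0] e by (simp add: X00)
  have dg: "((\<lambda>t. g (X t) \<bullet> h) has_real_derivative (H x0 *v h) \<bullet> h) (at 0)"
    using C2_with_DERIV_line(2)[OF C2, of x0 0 h h] \<Omega> by (simp add: X_def)
  have "(\<psi>1 has_real_derivative
      (m * (sgn x0 \<bullet> h) * (sgn x0 \<bullet> h)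
       + ((h \<bullet> h) * ?r - (x0 \<bullet> h) * (sgn x0 \<bullet> h)) / (?r * ?r) * u1 ?r) - (H x0 *v h) \<bullet> h) (at 0)"
    unfolding \<psi>1_def using DERIV_diff[OF DERIV_mult[OF du1 s] dg] by (simp add: sg X00)
  moreover have "m * (sgn x0 \<bullet> h) * (sgn x0 \<bullet> h)
       + ((h \<bullet> h) * ?r - (x0 \<bullet> h) * (sgn x0 \<bullet> h)) / (?r * ?r) * u1 ?r
    = h \<bullet> (radial_hessian (sgn x0) m ?l *v h)"
  proof -
    have "x0 \<bullet> h = ?r * (sgn x0 \<bullet> h)" using \<Omega> by (simp add: sg)
    moreover have "h \<bullet> sgn x0 = sgn x0 \<bullet> h" by (rule inner_commute)
    ultimately show ?thesis using \<Omega> by (simp add: radial_hessian_mult inner_add_right field_simps)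
  qed
  ultimately have dd: "(\<psi>1 has_real_derivative
      h \<bullet> (radial_hessian (sgn x0) m ?l *v h) - h \<bullet> (H x0 *v h)) (at 0)"
    by (simp add: inner_commute)
  have mx: "\<psi> t \<le> \<psi> 0" if "\<bar>t\<bar> < e" for t
    using d1(2)[of "X t"] X[OF that] by (simp add: \<psi>_def X00 d3_def dist_norm)
  from local_max_second_derivative[OF e d\<psi> dd mx] show ?thesis by simp
qed

section \<open>From the radial equation to viscosity solutions in the annulus\<close>

lemma minus_matrix_vector_mult: "(*v) (- A) = (\<lambda>x. - (A *v x))" for A :: "real^'n^'m"
  by (simp add: fun_eq_iff matrix_vector_mult_def vec_eq_iff sum_negf)

lemma C2_with_minus: "C2_with S \<phi> g H \<Longrightarrow> C2_with S (\<lambda>x. - \<phi> x) (\<lambda>x. - g x) (\<lambda>x. - H x)"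
  unfolding C2_with_def
  by (auto intro!: GDERIV_minus continuous_on_minus has_derivative_minus
      simp: minus_matrix_vector_mult)

lemma open_annulus: "open (annulus a b)"
  unfolding annulus_def by (intro open_Collect_conj open_Collect_less continuous_intros)

lemma closure_annulus_subset: "closure (annulus a b) \<subseteq> {x. a \<le> norm x \<and> norm x \<le> b}"
  by (rule closure_minimal)
    (auto simp: annulus_def intro!: closed_Collect_conj closed_Collect_le continuous_intros)

lemma pos_part_divide: "0 < r \<Longrightarrow> pos_part (x / r) = pos_part x / r"
  and neg_part_divide: "0 < r \<Longrightarrow> neg_part (x / r) = neg_part x / r"
  by (auto simp: pos_part_def neg_part_def max_def field_simps)

text \<open>\<open>nonconst\<close> rules out the locally constant alternative, so the test-function
  condition decides. There the touching lemmas compare the test Hessian with the radial one,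
  monotonicity of \<open>F\<close> passes this on to the operator, and the radial equation closes
  both inequalities.\<close>

lemma radial_dirichlet_solution:
  fixes F :: "real^'n^'n \<Rightarrow> real"
  assumes "0 < a" and F: "uniformly_elliptic lam Lam F" "0 < lam"
    and hess: "\<And>(e::real^'n) m l. norm e = 1 \<Longrightarrow> F (radial_hessian e m l) =
      (real CARD('n) - 1) * (kp * pos_part l - km * neg_part l) + Kp * pos_part m - Km * neg_part m"
    and u: "continuous_on {a..b} u" "u a = 0" "u b = 0"
    and pos: "\<And>r. a < r \<Longrightarrow> r < b \<Longrightarrow> 0 < u r"
    and du: "\<And>r. a < r \<Longrightarrow> r < b \<Longrightarrow> (u has_real_derivative u1 r) (at r)"
    and ode: "\<And>r. a < r \<Longrightarrow> r < b \<Longrightarrow> u1 r \<noteq> 0 \<Longrightarrow> \<exists>m. (u1 has_real_derivative m) (at r) \<and>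
      \<bar>u1 r\<bar> powr \<alpha> * ((real CARD('n) - 1) / r * (kp * pos_part (u1 r) - km * neg_part (u1 r))
        + Kp * pos_part m - Km * neg_part m) + u r powr p = 0"
    and nonconst: "\<And>r d. a < r \<Longrightarrow> r < b \<Longrightarrow> 0 < d \<Longrightarrow> \<exists>s. a < s \<and> s < b \<and> \<bar>s - r\<bar> < d \<and> u s \<noteq> u r"
  shows "dirichlet_solution \<alpha> p F (annulus a b) (\<lambda>x. u (norm x))"
proof -
  have cont: "continuous_on (closure (annulus a b)) (\<lambda>x :: real^'n. u (norm x))"
    using closure_annulus_subset[of a b]
    by (intro continuous_on_compose2[OF u(1)] continuous_intros) auto
  have nc: "\<not> constant_near (annulus a b) (\<lambda>x. u (norm x)) c x0" if x0: "x0 \<in> annulus a b"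
    for c and x0 :: "real^'n"
  proof
    assume "constant_near (annulus a b) (\<lambda>x. u (norm x)) c x0"
    then obtain d where d: "0 < d" "\<And>x. x \<in> ball x0 d \<Longrightarrow> u (norm x) = c"
      unfolding constant_near_def by blast
    have r: "a < norm x0" "norm x0 < b" using x0 by (auto simp: annulus_def)
    then obtain s where s: "a < s" "\<bar>s - norm x0\<bar> < d" "u s \<noteq> u (norm x0)"
      using nonconst d by blast
    \<comment> \<open>The point of norm \<open>s\<close> on the ray through \<open>x0\<close>; its
      distance to \<open>x0\<close> is exactly \<open>\<bar>s - norm x0\<bar>\<close>.\<close>
    define x where "x = (s / norm x0) *\<^sub>R x0"
    have "x0 \<noteq> 0" using r \<open>0 < a\<close> by auto
    then have nx: "norm x = s" using s \<open>0 < a\<close> by (simp add: x_def)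
    have "x0 - x = (1 - s / norm x0) *\<^sub>R x0" by (simp add: x_def algebra_simps)
    then have "dist x0 x = \<bar>1 - s / norm x0\<bar> * norm x0" by (simp add: dist_norm)
    also have "\<dots> = \<bar>(1 - s / norm x0) * norm x0\<bar>" by (simp add: abs_mult)
    also have "(1 - s / norm x0) * norm x0 = norm x0 - s"
      using \<open>x0 \<noteq> 0\<close> by (simp add: left_diff_distrib)
    finally have "x \<in> ball x0 d" using s by (simp add: abs_minus_commute)
    then show False using d(2)[of x] d(2)[of x0] d(1) nx s by simp
  qed
  have up: "\<bar>u r\<bar> powr (p - 1) * u r = u r powr p" if "a < r" "r < b" for r
    using pos[OF that] powr_add[of "u r" "p - 1" 1] by simp
  have eq: "norm (g x0) powr \<alpha> * F (radial_hessian (sgn x0) m (u1 (norm x0) / norm x0))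
      + \<bar>u (norm x0)\<bar> powr (p - 1) * u (norm x0) = 0"
    if x0: "x0 \<in> annulus a b" and g: "g x0 = u1 (norm x0) *\<^sub>R sgn x0"
      and m: "\<bar>u1 (norm x0)\<bar> powr \<alpha> * ((real CARD('n) - 1) / norm x0 *
        (kp * pos_part (u1 (norm x0)) - km * neg_part (u1 (norm x0)))
        + Kp * pos_part m - Km * neg_part m) + u (norm x0) powr p = 0"
    for x0 m and g :: "real^'n \<Rightarrow> real^'n"
  proof -
    have r: "a < norm x0" "norm x0 < b" using x0 by (auto simp: annulus_def)
    then have "norm (sgn x0) = 1" "0 < norm x0" using \<open>0 < a\<close> by (auto simp: norm_sgn)
    then show ?thesis
      using m up[OF r] by (simp add: g hess pos_part_divide neg_part_divide field_simps)
  qed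
  have sub: "norm (g x0) powr \<alpha> * F (H x0) + \<bar>u (norm x0)\<bar> powr (p - 1) * u (norm x0) \<ge> 0"
    if x0: "x0 \<in> annulus a b" and C2: "C2_with (annulus a b) \<phi> g H" and g0: "g x0 \<noteq> 0"
      and touch: "\<forall>\<^sub>F x in at x0 within annulus a b. u (norm x) - \<phi> x \<le> u (norm x0) - \<phi> x0"
    for x0 :: "real^'n" and \<phi> g H
  proof -
    have r: "a < norm x0" "norm x0 < b" using x0 by (auto simp: annulus_def)
    have x00: "x0 \<noteq> 0" using r \<open>0 < a\<close> by auto
    have g: "g x0 = u1 (norm x0) *\<^sub>R sgn x0"
      by (rule radial_touching_gradient[OF C2 open_annulus x0 x00 du[OF r] touch])
    then obtain m where m: "(u1 has_real_derivative m) (at (norm x0))"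
      "\<bar>u1 (norm x0)\<bar> powr \<alpha> * ((real CARD('n) - 1) / norm x0 *
        (kp * pos_part (u1 (norm x0)) - km * neg_part (u1 (norm x0)))
        + Kp * pos_part m - Km * neg_part m) + u (norm x0) powr p = 0"
      using ode[OF r] g0 by fastforce
    have d: "0 < min (norm x0 - a) (b - norm x0)" using r by simp
    have "F (radial_hessian (sgn x0) m (u1 (norm x0) / norm x0)) \<le> F (H x0)"
      by (rule uniformly_elliptic_mono[OF F symmetric_radial_hessian C2_with_symmetric[OF C2 open_annulus x0]])
        (rule radial_touching_above[OF C2 open_annulus x0 x00 d du m(1) touch];
          auto simp: abs_less_iff)
    then have "norm (g x0) powr \<alpha> * F (radial_hessian (sgn x0) m (u1 (norm x0) / norm x0))
        \<le> norm (g x0) powr \<alpha> * F (H x0)" by (intro mult_left_mono) auto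
    then show ?thesis using eq[of x0 g m] x0 g m(2) by linarith
  qed
  have super: "norm (g x0) powr \<alpha> * F (H x0) + \<bar>u (norm x0)\<bar> powr (p - 1) * u (norm x0) \<le> 0"
    if x0: "x0 \<in> annulus a b" and C2: "C2_with (annulus a b) \<phi> g H" and g0: "g x0 \<noteq> 0"
      and touch: "\<forall>\<^sub>F x in at x0 within annulus a b. u (norm x) - \<phi> x \<ge> u (norm x0) - \<phi> x0"
    for x0 :: "real^'n" and \<phi> g H
  proof -
    have r: "a < norm x0" "norm x0 < b" using x0 by (auto simp: annulus_def)
    have x00: "x0 \<noteq> 0" using r \<open>0 < a\<close> by auto
    \<comment> \<open>Touching from below is touching from above for \<open>- u\<close> and
      \<open>- \<phi>\<close>; the resulting matrix inequality is then negated back.\<close>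
    have touch': "\<forall>\<^sub>F x in at x0 within annulus a b. - u (norm x) - - \<phi> x \<le> - u (norm x0) - - \<phi> x0"
      using touch by (rule eventually_mono) simp
    note du' = DERIV_minus[OF du]
    have "- g x0 = - u1 (norm x0) *\<^sub>R sgn x0"
      by (rule radial_touching_gradient[OF C2_with_minus[OF C2] open_annulus x0 x00 du'[OF r] touch'])
    then have g: "g x0 = u1 (norm x0) *\<^sub>R sgn x0" by simp
    then obtain m where m: "(u1 has_real_derivative m) (at (norm x0))"
      "\<bar>u1 (norm x0)\<bar> powr \<alpha> * ((real CARD('n) - 1) / norm x0 *
        (kp * pos_part (u1 (norm x0)) - km * neg_part (u1 (norm x0)))
        + Kp * pos_part m - Km * neg_part m) + u (norm x0) powr p = 0"
      using ode[OF r] g0 by fastforce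
    have d: "0 < min (norm x0 - a) (b - norm x0)" using r by simp
    have "h \<bullet> (radial_hessian (sgn x0) (- m) (- u1 (norm x0) / norm x0) *v h) \<le> h \<bullet> (- H x0 *v h)" for h
      by (rule radial_touching_above[OF C2_with_minus[OF C2] open_annulus x0 x00 d du' DERIV_minus[OF m(1)] touch'])
        (auto simp: abs_less_iff)
    then have "h \<bullet> (H x0 *v h) \<le> h \<bullet> (radial_hessian (sgn x0) m (u1 (norm x0) / norm x0) *v h)" for h
      by (simp add: minus_matrix_vector_mult flip: minus_radial_hessian)
    then have "F (H x0) \<le> F (radial_hessian (sgn x0) m (u1 (norm x0) / norm x0))"
      by (rule uniformly_elliptic_mono[OF F C2_with_symmetric[OF C2 open_annulus x0] symmetric_radial_hessian])
    then have "norm (g x0) powr \<alpha> * F (H x0)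
        \<le> norm (g x0) powr \<alpha> * F (radial_hessian (sgn x0) m (u1 (norm x0) / norm x0))"
      by (intro mult_left_mono) auto
    then show ?thesis using eq[of x0 g m] x0 g m(2) by linarith
  qed
  have fr: "u (norm x) = 0" if "x \<in> frontier (annulus a b)" for x :: "real^'n"
  proof -
    have "x \<in> closure (annulus a b)" "x \<notin> annulus a b"
      using that interior_open[OF open_annulus, of a b] by (auto simp: frontier_def)
    then have "a \<le> norm x" "norm x \<le> b" "\<not> (a < norm x \<and> norm x < b)"
      using closure_annulus_subset[of a b] by (auto simp: annulus_def)
    then show ?thesis using u by (metis order_le_less)
  qed
  show ?thesis
    unfolding dirichlet_solution_def viscosity_solution_def viscosity_subsolution_def
      viscosity_supersolution_def
    using cont nc sub super fr by blast
qed

section \<open>Positive and negative radial solutions\<close>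

lemma signed_powr_eq_0_iff: "signed_powr q v = 0 \<longleftrightarrow> v = 0"
  by (metis abs_signed_powr abs_0_eq powr_eq_0_iff)

lemma DERIV_signed_powr:
  assumes "v \<noteq> 0"
  shows "(signed_powr q has_real_derivative q * \<bar>v\<bar> powr (q - 1)) (at v)"
proof (cases "0 < v")
  case True
  have "((\<lambda>v. v powr q) has_real_derivative q * \<bar>v\<bar> powr (q - 1)) (at v)"
    using True by (auto intro!: derivative_eq_intros)
  then show ?thesis
    by (rule has_field_derivative_transform_within_open[of _ _ _ "{0<..}"])
      (use True in \<open>auto simp: signed_powr_nonneg\<close>)
next
  case False
  have "((\<lambda>v. - ((- v) powr q)) has_real_derivative q * \<bar>v\<bar> powr (q - 1)) (at v)"
    using False assms by (auto intro!: derivative_eq_intros)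
  then show ?thesis
    by (rule has_field_derivative_transform_within_open[of _ _ _ "{..<0}"])
      (use False assms in \<open>auto simp: signed_powr_nonpos\<close>)
qed

text \<open>The behaviour of \<open>F\<close> on radial Hessians is assumed in algebraic form
  because in that form it passes to \<open>- F (- M)\<close> by an exchange of constants, which
  yields the negative solutions.\<close>

lemma radial_positive_solution:
  fixes F :: "real^'n^'n \<Rightarrow> real"
  assumes F: "uniformly_elliptic lam Lam F" "0 < lam"
    and k: "0 < kp" "0 < km" "0 < Kp" "0 < Km"
    and hess: "\<And>(e::real^'n) m l. norm e = 1 \<Longrightarrow> F (radial_hessian e m l) =
      (real CARD('n) - 1) * (kp * pos_part l - km * neg_part l) + Kp * pos_part m - Km * neg_part m"
    and \<alpha>: "- 1 < \<alpha>" "1 + \<alpha> < p" and ab: "0 < a" "a < b"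
  shows "\<exists>u. dirichlet_solution \<alpha> p F (annulus a b) u \<and> radial_on (closure (annulus a b)) u \<and>
    (\<forall>x\<in>annulus a b. 0 < u x)"
proof -
  define \<sigma> where "\<sigma> = 1 + \<alpha>"
  define q where "q = 1 / \<sigma>"
  define n where "n = real CARD('n) - 1"
  \<comment> \<open>\<open>- h z\<close> is the radial second derivative m that solves K^+ m^+ - K^-
    m^- = - z. A positive z forces m < 0, so \<open>Km\<close> belongs to the positive part; this is
    also the origin of \<open>c\<close>.\<close>
  define h where "h x = pos_part x / Km - neg_part x / Kp" for x
  define A where "A r v y = n / r * (kp * pos_part v - km * neg_part v) + y" for r v y
  define G where "G r v y = \<sigma> * h (A r v y)" for r v y
  define c where "c = \<sigma> / Km"
  define K where "K = max (1 / Km) (1 / Kp)"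
  define D where "D = \<sigma> * (K * (n / a * max kp km))"
  have \<sigma>: "0 < \<sigma>" "\<sigma> < p" using \<alpha> by (auto simp: \<sigma>_def)
  have q: "0 < q" "1 / q < p" "q * \<sigma> = 1" using \<sigma> by (auto simp: q_def)
  have n: "0 \<le> n"
    using zero_less_card_finite[where 'a='n] by (simp add: n_def)
  have K: "1 / Km \<le> K" "1 / Kp \<le> K" "0 < K" using k by (auto simp: K_def less_max_iff_disj)
  \<comment> \<open>\<open>y / Km\<close> is \<open>h y\<close>, and \<open>K\<close> is the larger
    of the two slopes of \<open>h\<close>, hence a Lipschitz constant.\<close>
  have h: "\<bar>h (x + y) - y / Km\<bar> \<le> K * \<bar>x\<bar>" if "0 \<le> y" for x y
  proof (cases "0 \<le> x + y")
    case True
    then have "h (x + y) - y / Km = 1 / Km * x"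
      by (simp add: h_def pos_part_def neg_part_def add_divide_distrib)
    then have "\<bar>h (x + y) - y / Km\<bar> = 1 / Km * \<bar>x\<bar>" using k by (simp add: abs_mult)
    also have "\<dots> \<le> K * \<bar>x\<bar>" using K(1) by (rule mult_right_mono) simp
    finally show ?thesis .
  next
    case False
    then have "h (x + y) - y / Km = - (1 / Kp * - (x + y) + 1 / Km * y)"
      by (simp add: h_def pos_part_def neg_part_def add_divide_distrib diff_divide_distrib)
    moreover have "0 \<le> 1 / Kp * - (x + y) + 1 / Km * y"
      using False that k by (intro add_nonneg_nonneg mult_nonneg_nonneg) auto
    ultimately have "\<bar>h (x + y) - y / Km\<bar> = 1 / Kp * - (x + y) + 1 / Km * y"
      by (simp only: abs_minus_cancel abs_of_nonneg)
    also have "\<dots> \<le> K * - (x + y) + K * y"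
      using K False that by (intro add_mono mult_right_mono) auto
    also have "\<dots> = K * \<bar>x\<bar>" using False that by (simp add: algebra_simps)
    finally show ?thesis .
  qed
  have Gbd: "\<bar>G r v y - c * y\<bar> \<le> D * \<bar>v\<bar>" if "r \<in> {a..b}" "0 \<le> y" for r v y
  proof -
    have "\<bar>kp * pos_part v - km * neg_part v\<bar> \<le> max kp km * \<bar>v\<bar>"
      using k by (cases "0 \<le> v") (auto simp: pos_part_def neg_part_def abs_mult mult_right_mono)
    moreover have "0 \<le> n / r" "n / r \<le> n / a" using that ab n by (auto intro: divide_left_mono)
    ultimately have "\<bar>n / r * (kp * pos_part v - km * neg_part v)\<bar> \<le> n / a * (max kp km * \<bar>v\<bar>)"
      unfolding abs_mult by (intro mult_mono) auto
    then have "K * \<bar>n / r * (kp * pos_part v - km * neg_part v)\<bar> \<le> K * (n / a * (max kp km * \<bar>v\<bar>))"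
      using K by (intro mult_left_mono) auto
    with h[OF that(2), of "n / r * (kp * pos_part v - km * neg_part v)"]
    have "\<bar>h (A r v y) - y / Km\<bar> \<le> K * (n / a * (max kp km * \<bar>v\<bar>))" unfolding A_def by linarith
    then have "\<sigma> * \<bar>h (A r v y) - y / Km\<bar> \<le> \<sigma> * (K * (n / a * (max kp km * \<bar>v\<bar>)))"
      using \<sigma> by (intro mult_left_mono) auto
    moreover have "G r v y - c * y = \<sigma> * (h (A r v y) - y / Km)"
      by (simp add: G_def c_def right_diff_distrib)
    ultimately show ?thesis using \<sigma> by (simp add: D_def abs_mult mult.assoc)
  qed
  have Gcont: "continuous_on ({a..b} \<times> UNIV \<times> {0..}) (\<lambda>(r, v, y). G r v y)"
    unfolding G_def h_def A_def pos_part_def neg_part_def case_prod_beta'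
    using ab k by (intro continuous_intros) auto
  obtain \<mu> U v where \<mu>: "0 < \<mu>" and U: "continuous_on {a..b} U" and "continuous_on {a..b} v"
    and ends: "U a = 0" "U b = 0" and pos: "\<And>x. a < x \<Longrightarrow> x < b \<Longrightarrow> 0 < U x"
    and dU: "\<And>x. a < x \<Longrightarrow> x < b \<Longrightarrow> (U has_real_derivative signed_powr q (v x)) (at x)"
    and dv: "\<And>x. a < x \<Longrightarrow> x < b \<Longrightarrow> (v has_real_derivative - G x (v x) (\<mu> * U x powr p)) (at x)"
    using positive_profile_exists[OF Gcont Gbd, of q p] k \<sigma> q ab n K by (auto simp: c_def D_def)
  \<comment> \<open>The equation has degree \<open>\<sigma>\<close> on the left and \<open>p\<close> on the right, so scaling removes \<open>\<mu>\<close>.\<close>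
  define s where "s = \<mu> powr (1 / (p - \<sigma>))"
  have s: "0 < s" "s powr (p - \<sigma>) = \<mu>" using \<mu> \<sigma> by (auto simp: s_def powr_powr)
  define u where "u r = s * U r" for r
  define u1 where "u1 r = s * signed_powr q (v r)" for r
  have ode: "\<exists>m. (u1 has_real_derivative m) (at r) \<and>
      \<bar>u1 r\<bar> powr \<alpha> * ((real CARD('n) - 1) / r * (kp * pos_part (u1 r) - km * neg_part (u1 r))
        + Kp * pos_part m - Km * neg_part m) + u r powr p = 0"
    if r: "a < r" "r < b" and ne: "u1 r \<noteq> 0" for r
  proof (intro exI conjI)
    have v: "v r \<noteq> 0" using ne s by (auto simp: u1_def signed_powr_eq_0_iff)
    define y where "y = \<mu> * U r powr p"
    define w where "w = \<bar>v r\<bar> powr (q - 1)"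
    define m where "m = s * w * - h (A r (v r) y)"
    have w: "0 < w" using v by (simp add: w_def)
    have "((\<lambda>r. signed_powr q (v r)) has_real_derivative q * w * - G r (v r) y) (at r)"
      using DERIV_chain2[OF DERIV_signed_powr[OF v] dv[OF r]] by (simp add: w_def y_def)
    moreover have "s * (q * w * - G r (v r) y) = (q * \<sigma>) * m" by (simp add: m_def G_def)
    ultimately show "(u1 has_real_derivative m) (at r)"
      using DERIV_cmult[of _ _ r UNIV s] q(3) unfolding u1_def[abs_def] by force
    have Km: "Kp * pos_part (- h z) - Km * neg_part (- h z) = - z" for z
      using k by (cases "0 \<le> z") (auto simp: h_def pos_part_def neg_part_def field_simps)
    have pn: "pos_part (t * z) = t * pos_part z" "neg_part (t * z) = t * neg_part z" if "0 < t" for t z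
      using that by (auto simp: pos_part_def neg_part_def max_def zero_le_mult_iff mult_le_0_iff)
    have spv: "signed_powr q (v r) = w * v r"
      using v powr_add[of "\<bar>v r\<bar>" "q - 1" 1]
      by (cases "0 \<le> v r") (simp_all add: signed_powr_nonneg signed_powr_nonpos w_def)
    have u1: "u1 r = (s * w) * v r" by (simp add: u1_def spv)
    have m: "m = (s * w) * - h (A r (v r) y)" by (simp add: m_def)
    have sw: "0 < s * w" using s w by simp
    \<comment> \<open>By homogeneity, passing from \<open>v\<close> to \<open>u1\<close> multiplies
      the bracket by \<open>s * w\<close>. Together with the factor
      \<open>\<bar>u1 r\<bar> powr \<alpha>\<close> the powers of \<open>\<bar>v r\<bar>\<close>
      cancel, because q \<alpha> + q - 1 = 0.\<close>
    have "\<bar>u1 r\<bar> = s * \<bar>v r\<bar> powr q" using s by (simp add: u1_def abs_mult abs_signed_powr)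
    then have "\<bar>u1 r\<bar> powr \<alpha> * (s * w) = s powr \<alpha> * s * (\<bar>v r\<bar> powr (q * \<alpha>) * \<bar>v r\<bar> powr (q - 1))"
      using s by (simp add: powr_mult powr_powr w_def)
    also have "\<bar>v r\<bar> powr (q * \<alpha>) * \<bar>v r\<bar> powr (q - 1) = 1"
      using v q(3) by (simp add: \<sigma>_def algebra_simps flip: powr_add)
    also have "s powr \<alpha> * s = s powr \<sigma>" using s powr_add[of s \<alpha> 1] by (simp add: \<sigma>_def add.commute)
    finally have W: "\<bar>u1 r\<bar> powr \<alpha> * (s * w) = s powr \<sigma>" by simp
    have "n / r * (kp * pos_part (u1 r) - km * neg_part (u1 r)) + Kp * pos_part m - Km * neg_part m
      = (s * w) * (n / r * (kp * pos_part (v r) - km * neg_part (v r))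
        + (Kp * pos_part (- h (A r (v r) y)) - Km * neg_part (- h (A r (v r) y))))"
      unfolding u1 m pn[OF sw] by (simp add: algebra_simps)
    also have "\<dots> = (s * w) * - y" unfolding Km by (simp add: A_def)
    finally have "\<bar>u1 r\<bar> powr \<alpha> * (n / r * (kp * pos_part (u1 r) - km * neg_part (u1 r))
        + Kp * pos_part m - Km * neg_part m) = s powr \<sigma> * - y"
      using W by (simp flip: mult.assoc)
    moreover have "u r powr p = s powr \<sigma> * y"
    proof -
      have "u r powr p = s powr (\<sigma> + (p - \<sigma>)) * U r powr p"
        using s pos[OF r] by (simp add: u_def powr_mult)
      then show ?thesis unfolding powr_add s(2) by (simp add: y_def)
    qed
    ultimately show "\<bar>u1 r\<bar> powr \<alpha> * ((real CARD('n) - 1) / r * (kp * pos_part (u1 r) - km * neg_part (u1 r))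
        + Kp * pos_part m - Km * neg_part m) + u r powr p = 0"
      by (simp add: n_def)
  qed
  \<comment> \<open>On an interval where \<open>U\<close> is constant, first its flux and then the
    derivative of the flux vanish. But at zero flux \<open>G\<close> equals \<open>c\<close> times
    the source, which is positive.\<close>
  have nonconst: "\<exists>t. a < t \<and> t < b \<and> \<bar>t - r\<bar> < d \<and> u t \<noteq> u r" if r: "a < r" "r < b" and d: "0 < d" for r d
  proof (rule ccontr)
    assume const: "\<not> ?thesis"
    define I where "I = {max a (r - d)<..<min b (r + d)}"
    have I: "open I" "r \<in> I" using r d by (auto simp: I_def)
    have Ut: "U t = U r" if "t \<in> I" for t
      using const that s by (auto simp: I_def u_def abs_less_iff)
    have vt: "v t = 0" if "t \<in> I" for t
    proof -
      have "(U has_real_derivative 0) (at t)"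
        using has_field_derivative_transform_within_open[OF DERIV_const I(1) that] Ut by force
      then have "signed_powr q (v t) = 0" using DERIV_unique dU[of t] that by (auto simp: I_def)
      then show ?thesis by (simp add: signed_powr_eq_0_iff)
    qed
    have "(v has_real_derivative 0) (at r)"
      using has_field_derivative_transform_within_open[OF DERIV_const I] vt by force
    then have "G r (v r) (\<mu> * U r powr p) = 0" using DERIV_unique dv[OF r] by force
    moreover have "0 < c * (\<mu> * U r powr p)" using \<mu> pos[OF r] \<sigma> k by (simp add: c_def)
    ultimately show False using Gbd[of r "\<mu> * U r powr p" "v r"] vt[OF I(2)] r \<mu> by simp
  qed
  have "dirichlet_solution \<alpha> p F (annulus a b) (\<lambda>x. u (norm x))"
  proof (rule radial_dirichlet_solution[OF ab(1) F hess _ _ _ _ _ ode nonconst])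
    show "continuous_on {a..b} u" unfolding u_def by (intro continuous_intros U)
    show "(u has_real_derivative u1 r) (at r)" if "a < r" "r < b" for r
      using DERIV_cmult[OF dU[OF that], of s] by (simp add: u_def[abs_def] u1_def)
  qed (use ends pos s in \<open>auto simp: u_def\<close>)
  moreover have "radial_on (closure (annulus a b)) (\<lambda>x :: real^'n. u (norm x))"
    unfolding radial_on_def by blast
  moreover have "\<forall>x\<in>annulus a b. 0 < u (norm (x :: real^'n))"
    using pos s by (simp add: annulus_def u_def)
  ultimately show ?thesis by blast
qed

section \<open>Sign reversal\<close>

lemma constant_near_minus: "constant_near \<Omega> (\<lambda>x. - u x) c x0 \<longleftrightarrow> constant_near \<Omega> u (- c) x0"
proof -
  have "- u x = c \<longleftrightarrow> u x = - c" for x by linarith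
  then show ?thesis by (simp add: constant_near_def)
qed

text \<open>If \<open>\<phi>\<close> touches \<open>- u\<close> from above, then
  \<open>- \<phi>\<close> touches \<open>u\<close> from below. The zero-order term is odd, so the
  inequality for \<open>- F (- M)\<close> changes sign into the one for \<open>F\<close>; the
  constant case follows the same pattern.\<close>

lemma viscosity_subsolution_minus:
  fixes F :: "real^'n^'n \<Rightarrow> real"
  assumes u: "viscosity_supersolution \<alpha> p (\<lambda>M. - F (- M)) \<Omega> u"
  shows "viscosity_subsolution \<alpha> p F \<Omega> (\<lambda>x. - u x)"
  unfolding viscosity_subsolution_def
proof (intro conjI ballI)
  show "continuous_on (closure \<Omega>) (\<lambda>x. - u x)"
    using u unfolding viscosity_supersolution_def by (intro continuous_on_minus) blast
  fix x0 assume x0: "x0 \<in> \<Omega>"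
  show "(\<exists>c. constant_near \<Omega> (\<lambda>x. - u x) c x0 \<and> \<bar>c\<bar> powr (p - 1) * c \<ge> 0) \<or>
    ((\<nexists>c. constant_near \<Omega> (\<lambda>x. - u x) c x0) \<and>
      (\<forall>\<phi> g H. C2_with \<Omega> \<phi> g H \<longrightarrow>
        (\<forall>\<^sub>F x in at x0 within \<Omega>. - u x - \<phi> x \<le> - u x0 - \<phi> x0) \<longrightarrow> g x0 \<noteq> 0 \<longrightarrow>
        norm (g x0) powr \<alpha> * F (H x0) + \<bar>- u x0\<bar> powr (p - 1) * - u x0 \<ge> 0))"
  proof (cases "\<exists>c. constant_near \<Omega> u c x0")
    case True
    then obtain c where c: "constant_near \<Omega> u c x0" "\<bar>c\<bar> powr (p - 1) * c \<le> 0"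
      using u x0 unfolding viscosity_supersolution_def by blast
    then show ?thesis
      by (intro disjI1 exI[of _ "- c"]) (simp add: constant_near_minus)
  next
    case False
    then have test: "\<forall>\<phi> g H. C2_with \<Omega> \<phi> g H \<longrightarrow>
        (\<forall>\<^sub>F x in at x0 within \<Omega>. u x - \<phi> x \<ge> u x0 - \<phi> x0) \<longrightarrow> g x0 \<noteq> 0 \<longrightarrow>
        norm (g x0) powr \<alpha> * - F (- H x0) + \<bar>u x0\<bar> powr (p - 1) * u x0 \<le> 0"
      using u x0 unfolding viscosity_supersolution_def by blast
    have "norm (g x0) powr \<alpha> * F (H x0) + \<bar>- u x0\<bar> powr (p - 1) * - u x0 \<ge> 0"
      if C2: "C2_with \<Omega> \<phi> g H" and g: "g x0 \<noteq> 0"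
        and touch: "\<forall>\<^sub>F x in at x0 within \<Omega>. - u x - \<phi> x \<le> - u x0 - \<phi> x0" for \<phi> g H
    proof -
      have "\<forall>\<^sub>F x in at x0 within \<Omega>. u x - - \<phi> x \<ge> u x0 - - \<phi> x0"
        using touch by (rule eventually_mono) simp
      then have "norm (- g x0) powr \<alpha> * - F (- (- H x0)) + \<bar>u x0\<bar> powr (p - 1) * u x0 \<le> 0"
        using test[rule_format, OF C2_with_minus[OF C2]] g by simp
      then show ?thesis by simp
    qed
    then show ?thesis using False by (auto simp: constant_near_minus)
  qed
qed

lemma viscosity_supersolution_minus:
  fixes F :: "real^'n^'n \<Rightarrow> real"
  assumes u: "viscosity_subsolution \<alpha> p (\<lambda>M. - F (- M)) \<Omega> u"
  shows "viscosity_supersolution \<alpha> p F \<Omega> (\<lambda>x. - u x)"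
  unfolding viscosity_supersolution_def
proof (intro conjI ballI)
  show "continuous_on (closure \<Omega>) (\<lambda>x. - u x)"
    using u unfolding viscosity_subsolution_def by (intro continuous_on_minus) blast
  fix x0 assume x0: "x0 \<in> \<Omega>"
  show "(\<exists>c. constant_near \<Omega> (\<lambda>x. - u x) c x0 \<and> \<bar>c\<bar> powr (p - 1) * c \<le> 0) \<or>
    ((\<nexists>c. constant_near \<Omega> (\<lambda>x. - u x) c x0) \<and>
      (\<forall>\<phi> g H. C2_with \<Omega> \<phi> g H \<longrightarrow>
        (\<forall>\<^sub>F x in at x0 within \<Omega>. - u x - \<phi> x \<ge> - u x0 - \<phi> x0) \<longrightarrow> g x0 \<noteq> 0 \<longrightarrow>
        norm (g x0) powr \<alpha> * F (H x0) + \<bar>- u x0\<bar> powr (p - 1) * - u x0 \<le> 0))"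
  proof (cases "\<exists>c. constant_near \<Omega> u c x0")
    case True
    then obtain c where c: "constant_near \<Omega> u c x0" "\<bar>c\<bar> powr (p - 1) * c \<ge> 0"
      using u x0 unfolding viscosity_subsolution_def by blast
    then show ?thesis
      by (intro disjI1 exI[of _ "- c"]) (simp add: constant_near_minus)
  next
    case False
    then have test: "\<forall>\<phi> g H. C2_with \<Omega> \<phi> g H \<longrightarrow>
        (\<forall>\<^sub>F x in at x0 within \<Omega>. u x - \<phi> x \<le> u x0 - \<phi> x0) \<longrightarrow> g x0 \<noteq> 0 \<longrightarrow>
        norm (g x0) powr \<alpha> * - F (- H x0) + \<bar>u x0\<bar> powr (p - 1) * u x0 \<ge> 0"
      using u x0 unfolding viscosity_subsolution_def by blast
    have "norm (g x0) powr \<alpha> * F (H x0) + \<bar>- u x0\<bar> powr (p - 1) * - u x0 \<le> 0"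
      if C2: "C2_with \<Omega> \<phi> g H" and g: "g x0 \<noteq> 0"
        and touch: "\<forall>\<^sub>F x in at x0 within \<Omega>. - u x - \<phi> x \<ge> - u x0 - \<phi> x0" for \<phi> g H
    proof -
      have "\<forall>\<^sub>F x in at x0 within \<Omega>. u x - - \<phi> x \<le> u x0 - - \<phi> x0"
        using touch by (rule eventually_mono) simp
      then have "norm (- g x0) powr \<alpha> * - F (- (- H x0)) + \<bar>u x0\<bar> powr (p - 1) * u x0 \<ge> 0"
        using test[rule_format, OF C2_with_minus[OF C2]] g by simp
      then show ?thesis by simp
    qed
    then show ?thesis using False by (auto simp: constant_near_minus)
  qed
qed

lemma dirichlet_solution_minus:
  "dirichlet_solution \<alpha> p (\<lambda>M. - F (- M)) \<Omega> u \<Longrightarrow> dirichlet_solution \<alpha> p F \<Omega> (\<lambda>x. - u x)"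
  by (simp add: dirichlet_solution_def viscosity_solution_def
      viscosity_subsolution_minus viscosity_supersolution_minus)

text \<open>The two-sided bound is used at the base point \<open>- M - M'\<close>, from which adding
  \<open>M'\<close> leads to \<open>- M\<close>.\<close>

lemma uniformly_elliptic_minus:
  assumes F: "uniformly_elliptic lam Lam F"
  shows "uniformly_elliptic lam Lam (\<lambda>M. - F (- M))"
  unfolding uniformly_elliptic_def
proof (intro allI impI)
  fix M M' :: "real^'a^'a" assume M: "symmetric_matrix M" and M': "nonneg_matrix M'"
  have "symmetric_matrix (- M - M')"
    using M M' by (simp add: nonneg_matrix_def symmetric_matrix_def transpose_def vec_eq_iff)
  then have "lam * trace M' \<le> F ((- M - M') + M') - F (- M - M') \<and>
      F ((- M - M') + M') - F (- M - M') \<le> Lam * trace M'"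
    using F M' unfolding uniformly_elliptic_def by blast
  then show "lam * trace M' \<le> - F (- (M + M')) - - F (- M) \<and>
      - F (- (M + M')) - - F (- M) \<le> Lam * trace M'"
    by simp
qed

lemma pos_part_minus: "pos_part (- x) = neg_part x"
  and neg_part_minus: "neg_part (- x) = pos_part x"
  by (simp_all add: pos_part_def neg_part_def)

theorem theorem1p4:
  fixes F :: "real^'n^'n \<Rightarrow> real" and lam Lam \<alpha> p a b :: real
  assumes "0 < lam" and "lam < Lam"
    and "F 0 = 0"
    and "uniformly_elliptic lam Lam F"
    and "\<exists>kp km Kp Km. lam \<le> kp \<and> kp \<le> Kp \<and> Kp \<le> Lam \<and>
           lam \<le> km \<and> km \<le> Km \<and> Km \<le> Lam \<and> radial_formula F kp km Kp Km"
    and "- 1 < \<alpha>" and "1 + \<alpha> < p"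
    and "0 < a" and "a < b"
  shows "(\<exists>u. dirichlet_solution \<alpha> p F (annulus a b) u \<and> radial_on (closure (annulus a b)) u \<and>
              (\<forall>x\<in>annulus a b. 0 < u x)) \<and>
         (\<exists>u. dirichlet_solution \<alpha> p F (annulus a b) u \<and> radial_on (closure (annulus a b)) u \<and>
              (\<forall>x\<in>annulus a b. u x < 0))"
proof
  obtain kp km Kp Km where "lam \<le> kp" "kp \<le> Kp" "lam \<le> km" "km \<le> Km"
    and rad: "radial_formula F kp km Kp Km"
    using assms by blast
  then have k: "0 < kp" "0 < km" "0 < Kp" "0 < Km" using \<open>0 < lam\<close> by auto
  note hess = radial_formula_hessian[OF rad]
  show "\<exists>u. dirichlet_solution \<alpha> p F (annulus a b) u \<and> radial_on (closure (annulus a b)) u \<and>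
      (\<forall>x\<in>annulus a b. 0 < u x)"
    by (rule radial_positive_solution[OF assms(4,1) k hess]) (use assms in auto)
  \<comment> \<open>Negation exchanges positive and negative parts, so the upper and lower constants
    trade places; only their positivity is required afterwards.\<close>
  have hess': "- F (- radial_hessian e m l) =
      (real CARD('n) - 1) * (km * pos_part l - kp * neg_part l) + Km * pos_part m - Kp * neg_part m"
    if "norm e = 1" for e :: "real^'n" and m l
    unfolding minus_radial_hessian hess[OF that] pos_part_minus neg_part_minus
    by (simp add: algebra_simps)
  obtain u where "dirichlet_solution \<alpha> p (\<lambda>M. - F (- M)) (annulus a b) u"
    "radial_on (closure (annulus a b)) u" "\<forall>x\<in>annulus a b. 0 < u x"
    using radial_positive_solution[OF uniformly_elliptic_minus[OF assms(4)] assms(1) k(2,1,4,3) hess'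
        assms(6-9)] by blast
  then show "\<exists>u. dirichlet_solution \<alpha> p F (annulus a b) u \<and> radial_on (closure (annulus a b)) u \<and>
      (\<forall>x\<in>annulus a b. u x < 0)"
    by (intro exI[of _ "\<lambda>x. - u x"]) (auto simp: dirichlet_solution_minus radial_on_def)
qed

end
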